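(* Let $r\ge 2$, let $\vec n=(n_1,\dots,n_r)\in\mathbb N^r$ with $n=|\vec n|\ge 1$ and $N=n-n_1$, and let $w^{(j)}(x)=e^{a_jx-x^2}$, $j=1,\dots,r$, where $a_1=0$ and $a_1,\dots,a_r\in\mathbb R$ are pairwise distinct. For $j=2,\dots,r$ put $$t_j=\frac{a_j}{2},\qquad L_j(z)=\Big(\frac{z}{t_j}\Big)^{n_1}\prod_{\substack{i=2\\ i\ne j}}^r\Big(\frac{z-t_i}{t_j-t_i}\Big)^{n_i}.$$ For $0\le q\le n_j-1$ define coefficients $v_s^{(j,q)}$ by the polynomial identity $$\sum_{s=0}^{N-1}v_s^{(j,q)}z^{n_1+s}=L_j(z)\,\frac{(z-t_j)^q}{q!}\sum_{\mu=0}^{n_j-1-q}\frac1{\mu!}\left[\frac{d^\mu}{dz^\mu}\frac1{L_j(z)}\right]_{z=t_j}(z-t_j)^\mu .$$ For $0\le b\le n_j-1$, $0\le m\le n_1-1$, $0\le s\le N-1$ put $$U^{(j)}_{b,s}=\frac{e^{-t_j^2}}{\sqrt\pi}\sum_{q=b}^{n_j-1}(-1)^{q-b}2^q t_j^{\,q-b}\binom qb v_s^{(j,q)},\qquad \Gamma_{m,s}=\sum_{j=2}^r\sum_{q=0}^{\min(m,n_j-1)}q!\binom mq t_j^{\,m-q}v_s^{(j,q)}.$$ Then the multiple Hermite Christoffel–Darboux kernel is $$K_{\vec n}(x,y)=e^{-y^2}\sum_{m=0}^{n_1-1}\frac{2^m\widehat H_m(y)}{\sqrt\pi\,m!}\Big(\widehat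 H_m(x)-\sum_{s=0}^{N-1}\Gamma_{m,s}\widehat H_{n_1+s}(x)\Big)+\sum_{s=0}^{N-1}\sum_{j=2}^r\sum_{b=0}^{n_j-1}U^{(j)}_{b,s}\,\widehat H_{n_1+s}(x)\,\widehat H_b(y)\,e^{a_jy-y^2}.$$
   Context: $\mathbb N=\{0,1,2,\dots\}$. $\widehat H_m(x)=\frac{(-1)^m}{2^m}e^{x^2}\frac{d^m}{dx^m}e^{-x^2}$ is the monic Hermite polynomial of degree $m$ (orthogonal for $e^{-x^2}$ on $\mathbb R$). For a multi-index $\vec m=(m_1,\dots,m_r)$: the type II polynomial $P_{\vec m}$ is the monic polynomial of degree $|\vec m|=\sum_j m_j$ with $\int_{\mathbb R}P_{\vec m}(x)x^k w^{(j)}(x)\,dx=0$ for $k=0,\dots,m_j-1$, $j=1,\dots,r$. The type I linear form is $Q_{\vec m}(x)=\sum_{j=1}^r A_j(x)w^{(j)}(x)$, where the $A_j$ are polynomials with $\deg A_j\le m_j-1$ such that $\int_{\mathbb R}Q_{\vec m}(x)x^k\,dx=0$ for $k=0,\dots,|\vec m|-2$ and $=1$ for $k=|\vec m|-1$. For the weights in question these objects exist and are unique for every nonzero multi-index (the system is perfect). Kernel: let $\vec n_0=\vec 0,\vec n_1,\dots,\vec n_n=\vec n$ be the natural path, i.e. $|\vec n_j|=j$ and the path first increases the first component by unit steps from $0$ to $n_1$, then the second component from $0$ to $n_2$, and so on. Then $K_{\vec n}(x,y)=\sum_{j=0}^{n-1}P_{\vec n_j}(x)Q_{\vec n_{j+1}}(y)$.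 Empty sums are $0$, empty products are $1$. *)

theory Defs
  imports "HOL-Analysis.Analysis" "HOL-Computational_Algebra.Polynomial"
begin

text \<open>Multi-indices of length \<open>r\<close> are functions on \<open>nat\<close> of which only the values at
  \<open>1, \<dots>, r\<close> matter; systems of weights \<open>w\<close> are indexed in the same way.\<close>

definition msize :: "nat \<Rightarrow> (nat \<Rightarrow> nat) \<Rightarrow> nat" where
  "msize r m = (\<Sum>j=1..r. m j)"

definition hermite_monic :: "nat \<Rightarrow> real \<Rightarrow> real" where
  "hermite_monic m x =
     (-1) ^ m / 2 ^ m * exp (x\<^sup>2) * (deriv ^^ m) (\<lambda>t. exp (- (t\<^sup>2))) x"

definition weight :: "(nat \<Rightarrow> real) \<Rightarrow> nat \<Rightarrow> real \<Rightarrow> real" where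
  "weight a j x = exp (a j * x - x\<^sup>2)"


section \<open>Multiple orthogonal polynomials\<close>

definition is_type_II ::
    "nat \<Rightarrow> (nat \<Rightarrow> real \<Rightarrow> real) \<Rightarrow> (nat \<Rightarrow> nat) \<Rightarrow> real poly \<Rightarrow> bool" where
  "is_type_II r w m P \<longleftrightarrow>
     lead_coeff P = 1 \<and> degree P = msize r m \<and>
     (\<forall>j\<in>{1..r}. \<forall>k<m j. has_bochner_integral lborel (\<lambda>x. poly P x * x ^ k * w j x) 0)"

definition type_II ::
    "nat \<Rightarrow> (nat \<Rightarrow> real \<Rightarrow> real) \<Rightarrow> (nat \<Rightarrow> nat) \<Rightarrow> real poly" where
  "type_II r w m = (THE P. is_type_II r w m P)"

text \<open>\<open>deg A\<^sub>j \<le> m\<^sub>j - 1\<close> is read with \<open>deg 0 = -\<infinity>\<close>, so \<open>m\<^sub>j = 0\<close> forces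
  \<open>A\<^sub>j = 0\<close>. Uniqueness is asked of the linear form as a function.\<close>

definition is_type_I_form ::
    "nat \<Rightarrow> (nat \<Rightarrow> real \<Rightarrow> real) \<Rightarrow> (nat \<Rightarrow> nat) \<Rightarrow> (real \<Rightarrow> real) \<Rightarrow> bool" where
  "is_type_I_form r w m Q \<longleftrightarrow>
     (\<exists>A :: nat \<Rightarrow> real poly.
        (\<forall>j\<in>{1..r}. A j = 0 \<or> degree (A j) < m j) \<and>
        Q = (\<lambda>x. \<Sum>j=1..r. poly (A j) x * w j x)) \<and>
     (\<forall>k<msize r m. has_bochner_integral lborel (\<lambda>x. Q x * x ^ k)
                      (if k = msize r m - 1 then 1 else 0))"

definition type_I_form ::
    "nat \<Rightarrow> (nat \<Rightarrow> real \<Rightarrow> real) \<Rightarrow> (nat \<Rightarrow> nat) \<Rightarrow> real \<Rightarrow> real" where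
  "type_I_form r w m = (THE Q. is_type_I_form r w m Q)"

text \<open>The natural path from \<open>0\<close> to \<open>n\<close>. After \<open>k\<close> steps, component \<open>j\<close> has received the steps
  not used up by the components before it, up to its maximum \<open>n j\<close>; the subtraction on \<open>nat\<close>
  truncates on purpose.\<close>

definition natural_path :: "(nat \<Rightarrow> nat) \<Rightarrow> nat \<Rightarrow> nat \<Rightarrow> nat" where
  "natural_path n k j = min (n j) (k - (\<Sum>i=1..<j. n i))"

lemma msize_natural_path: "msize r (natural_path n k) = min k (msize r n)"
proof (induction r)
  case 0
  then show ?case by (simp add: msize_def)
next
  case (Suc r)
  have "{1..<Suc r} = {1..r}" by auto
  with Suc show ?case by (simp add: msize_def natural_path_def)
qed

lemma natural_path_end:
  assumes "j \<in> {1..r}"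
  shows "natural_path n (msize r n) j = n j"
proof -
  have "(\<Sum>i=1..<j. n i) + n j = (\<Sum>i=1..<Suc j. n i)"
    using assms by simp
  also have "\<dots> \<le> msize r n"
    unfolding msize_def using assms by (intro sum_mono2) auto
  finally show ?thesis by (simp add: natural_path_def)
qed

definition cd_kernel ::
    "nat \<Rightarrow> (nat \<Rightarrow> real \<Rightarrow> real) \<Rightarrow> (nat \<Rightarrow> nat) \<Rightarrow> real \<Rightarrow> real \<Rightarrow> real" where
  "cd_kernel r w n x y =
     (\<Sum>k<msize r n. poly (type_II r w (natural_path n k)) x *
                      type_I_form r w (natural_path n (Suc k)) y)"


section \<open>Coefficients of the explicit formula\<close>

definition node :: "(nat \<Rightarrow> real) \<Rightarrow> nat \<Rightarrow> real" where
  "node a j = a j / 2"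

definition L_poly :: "nat \<Rightarrow> (nat \<Rightarrow> real) \<Rightarrow> (nat \<Rightarrow> nat) \<Rightarrow> nat \<Rightarrow> real poly" where
  "L_poly r a n j =
     smult (1 / node a j) [:0, 1:] ^ n 1 *
     (\<Prod>i\<in>{2..r} - {j}. smult (1 / (node a j - node a i)) [:- node a i, 1:] ^ n i)"

lemma poly_L_poly:
  "poly (L_poly r a n j) z =
     (z / node a j) ^ n 1 *
     (\<Prod>i\<in>{2..r} - {j}. ((z - node a i) / (node a j - node a i)) ^ n i)"
  by (simp add: L_poly_def poly_prod diff_divide_distrib)

definition interp_poly ::
    "nat \<Rightarrow> (nat \<Rightarrow> real) \<Rightarrow> (nat \<Rightarrow> nat) \<Rightarrow> nat \<Rightarrow> nat \<Rightarrow> real poly" where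
  "interp_poly r a n j q =
     L_poly r a n j * smult (1 / fact q) ([:- node a j, 1:] ^ q) *
     (\<Sum>\<mu><n j - q. smult (1 / fact \<mu> *
                            (deriv ^^ \<mu>) (\<lambda>z. 1 / poly (L_poly r a n j) z) (node a j))
                          ([:- node a j, 1:] ^ \<mu>))"

text \<open>The coefficients \<open>v\<^sub>s\<close> are read off from the polynomial; lemma \<open>vcoef_identity\<close>
  below is the identity that characterises them.\<close>

definition vcoef ::
    "nat \<Rightarrow> (nat \<Rightarrow> real) \<Rightarrow> (nat \<Rightarrow> nat) \<Rightarrow> nat \<Rightarrow> nat \<Rightarrow> nat \<Rightarrow> real" where
  "vcoef r a n j q s = coeff (interp_poly r a n j q) (n 1 + s)"

lemma degree_L_poly:
  "degree (L_poly r a n j) \<le> n 1 + (\<Sum>i\<in>{2..r} - {j}. n i)"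
proof -
  have lin: "degree (smult c [:d, 1:] ^ k) \<le> k" for c d :: real and k
    by (rule order_trans[OF degree_power_le]) (cases "c = 0"; simp)
  have "degree (\<Prod>i\<in>{2..r} - {j}. smult (1 / (node a j - node a i)) [:- node a i, 1:] ^ n i)
          \<le> (\<Sum>i\<in>{2..r} - {j}. n i)"
    by (rule order_trans[OF degree_prod_sum_le], simp)
       (unfold comp_def, rule sum_mono, rule lin)
  then show ?thesis
    unfolding L_poly_def
    by (intro order_trans[OF degree_mult_le] add_mono lin)
qed

lemma degree_interp_poly:
  assumes "j \<in> {2..r}" "q < n j"
  shows "degree (interp_poly r a n j q) < msize r n"
proof -
  have 1: "degree (smult (1 / fact q) ([:- node a j, 1:] ^ q)) \<le> q"
    by (simp add: degree_linear_power)
  have 2: "degree (\<Sum>\<mu><n j - q. smult (c \<mu>) ([:- node a j, 1:] ^ \<mu>)) \<le> n j - q - 1" for c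
  proof (rule degree_sum_le)
    fix \<mu> assume "\<mu> \<in> {..<n j - q}"
    moreover have "degree (smult (c \<mu>) ([:- node a j, 1:] ^ \<mu>)) \<le> \<mu>"
      by (simp add: degree_linear_power)
    ultimately show "degree (smult (c \<mu>) ([:- node a j, 1:] ^ \<mu>)) \<le> n j - q - 1"
      by auto
  qed simp
  have "degree (interp_poly r a n j q)
          \<le> (n 1 + (\<Sum>i\<in>{2..r} - {j}. n i)) + q + (n j - q - 1)"
    unfolding interp_poly_def
    by (intro order_trans[OF degree_mult_le] add_mono degree_L_poly 1 2)
  moreover have "msize r n = n 1 + (n j + (\<Sum>i\<in>{2..r} - {j}. n i))"
  proof -
    have "{1..r} = insert 1 {2..r}" using assms by auto
    then show ?thesis
      using assms by (simp add: msize_def sum.remove[of "{2..r}" j])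
  qed
  ultimately show ?thesis using assms by simp
qed

lemma vcoef_identity:
  assumes "j \<in> {2..r}" "q < n j"
  shows "(\<Sum>s<msize r n - n 1. vcoef r a n j q s * z ^ (n 1 + s)) =
           poly (L_poly r a n j) z * (z - node a j) ^ q / fact q *
           (\<Sum>\<mu><n j - q. 1 / fact \<mu> *
              (deriv ^^ \<mu>) (\<lambda>z. 1 / poly (L_poly r a n j) z) (node a j) *
              (z - node a j) ^ \<mu>)"
    (is "_ = ?rhs")
proof -
  let ?R = "interp_poly r a n j q"
  have low: "coeff ?R k = 0" if "k < n 1" for k
  proof -
    have eq: "smult c [:0, 1:] ^ n 1 = monom (c ^ n 1) (n 1)" for c :: real
      by (simp only: monom_altdef smult_power)
    have "\<exists>S. ?R = monom (c ^ n 1) (n 1) * S" if "c = 1 / node a j" for c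
      unfolding interp_poly_def L_poly_def that eq mult.assoc by blast
    then show ?thesis using \<open>k < n 1\<close> by (auto simp: coeff_monom_mult)
  qed
  have le: "n 1 \<le> msize r n"
    unfolding msize_def using assms by (intro member_le_sum) auto
  have "poly ?R z = (\<Sum>k<msize r n. coeff ?R k * z ^ k)"
    unfolding poly_altdef using degree_interp_poly[where n = n and j = j and a = a, OF assms]
    by (intro sum.mono_neutral_left) (auto simp: coeff_eq_0 not_le)
  also have "\<dots> = (\<Sum>k\<in>{n 1..<msize r n}. coeff ?R k * z ^ k)"
    by (rule sum.mono_neutral_right) (auto simp: low not_le)
  also have "\<dots> = (\<Sum>s<msize r n - n 1. vcoef r a n j q s * z ^ (n 1 + s))"
    unfolding vcoef_def
    by (rule sum.reindex_bij_witness[of _ "\<lambda>s. n 1 + s" "\<lambda>k. k - n 1"]) auto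
  finally have "(\<Sum>s<msize r n - n 1. vcoef r a n j q s * z ^ (n 1 + s)) = poly ?R z" ..
  also have "\<dots> = ?rhs"
    by (simp add: interp_poly_def poly_sum)
  finally show ?thesis .
qed

definition Ucoef ::
    "nat \<Rightarrow> (nat \<Rightarrow> real) \<Rightarrow> (nat \<Rightarrow> nat) \<Rightarrow> nat \<Rightarrow> nat \<Rightarrow> nat \<Rightarrow> real" where
  "Ucoef r a n j b s =
     exp (- ((node a j)\<^sup>2)) / sqrt pi *
     (\<Sum>q\<in>{b..<n j}. (-1) ^ (q - b) * 2 ^ q * node a j ^ (q - b) *
                        of_nat (q choose b) * vcoef r a n j q s)"

text \<open>The inner sum runs over \<open>0 \<le> q \<le> min m (n j - 1)\<close>, which is empty if \<open>n j = 0\<close>.\<close>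

definition Gammacoef ::
    "nat \<Rightarrow> (nat \<Rightarrow> real) \<Rightarrow> (nat \<Rightarrow> nat) \<Rightarrow> nat \<Rightarrow> nat \<Rightarrow> real" where
  "Gammacoef r a n m s =
     (\<Sum>j=2..r. \<Sum>q<min (Suc m) (n j).
        fact q * of_nat (m choose q) * node a j ^ (m - q) * vcoef r a n j q s)"

end

theory Submission
  imports Defs "HOL-Probability.Distributions"
    "HOL-Computational_Algebra.Polynomial_Factorial"
    "HOL-Computational_Algebra.Field_as_Ring"
begin

text \<open>The operator \<open>exp (- D\<^sup>2 / 4)\<close> sends \<open>z\<^sup>k\<close> to the monic Hermite polynomial of degree \<open>k\<close>,
  commutes with translations, and turns integration against the weight with node \<open>t\<close> into
  differentiation at \<open>t\<close>. Hence the type II polynomials are the images of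
  \<open>\<Prod>\<^sub>j (z - t\<^sub>j)\<^bsup>m\<^sub>j\<^esup>\<close>, and Hermite interpolation of the powers \<open>z\<^sup>k\<close>, \<open>k \<ge> n\<^sub>1\<close>, at the nodes
  yields a basis of the space of linear forms that is dual to the Hermite polynomials. Its last
  element is the type I form. Both the kernel and the explicit formula lie in this space as
  functions of \<open>y\<close> and reproduce all polynomials of degree less than \<open>|n|\<close>; since the pairing is
  nondegenerate, they agree.\<close>

section \<open>The Gaussian functional and the backward heat operator\<close>

definition gauss_int :: "real poly \<Rightarrow> real" where
  "gauss_int p = (LINT x|lborel. poly p x * exp (- (x\<^sup>2)))"

lemma gauss_moment_even:
  "has_bochner_integral lborel (\<lambda>x::real. x ^ (2 * k) * exp (- (x\<^sup>2)))
     (sqrt pi * (fact (2 * k) / (2 ^ (2 * k) * fact k)))"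
  using has_bochner_integral_even_function[OF gaussian_moment_even_pos[where k = k]]
  by (simp add: mult.commute)

lemma gauss_moment_odd:
  "has_bochner_integral lborel (\<lambda>x::real. x ^ Suc (2 * k) * exp (- (x\<^sup>2))) 0"
  using has_bochner_integral_odd_function[OF gaussian_moment_odd_pos[where k = k]]
  by (simp add: mult_ac)

lemma integrable_gauss_monom:
  "integrable lborel (\<lambda>x::real. x ^ k * exp (- (x\<^sup>2)))"
proof (cases "even k")
  case True
  then obtain m where "k = 2 * m" by (elim evenE)
  then show ?thesis using gauss_moment_even[of m] by (auto simp: has_bochner_integral_iff)
next
  case False
  then obtain m where "k = Suc (2 * m)" by (metis oddE Suc_eq_plus1)
  then show ?thesis using gauss_moment_odd[of m] by (auto simp: has_bochner_integral_iff)
qed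

lemma integrable_gauss_poly: "integrable lborel (\<lambda>x. poly p x * exp (- (x\<^sup>2)))"
  for p :: "real poly"
proof -
  have "integrable lborel (\<lambda>x. \<Sum>i\<le>degree p. coeff p i * (x ^ i * exp (- (x\<^sup>2))))"
    by (intro Bochner_Integration.integrable_sum integrable_mult_right integrable_gauss_monom)
  then show ?thesis by (simp add: poly_altdef sum_distrib_right mult.assoc)
qed

lemma gauss_int_add: "gauss_int (p + q) = gauss_int p + gauss_int q"
  by (simp add: gauss_int_def distrib_right integrable_gauss_poly)

lemma gauss_int_smult: "gauss_int (smult c p) = c * gauss_int p"
  by (simp add: gauss_int_def mult.assoc)

lemma gauss_int_diff: "gauss_int (p - q) = gauss_int p - gauss_int q"
  by (simp add: gauss_int_def left_diff_distrib integrable_gauss_poly)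

lemma gauss_int_sum: "gauss_int (\<Sum>i\<in>A. p i) = (\<Sum>i\<in>A. gauss_int (p i))"
proof (induction A rule: infinite_finite_induct)
qed (simp_all add: gauss_int_add, simp_all add: gauss_int_def)

lemma gauss_int_const [simp]: "gauss_int [:c:] = sqrt pi * c"
  using gauss_moment_even[of 0] by (simp add: gauss_int_def has_bochner_integral_iff)

text \<open>Integration by parts against \<open>exp (- (x^2))\<close>. No boundary terms are
  treated: both sides are linear, and on monomials the identity is the ratio of consecutive even
  moments, or says that odd moments vanish.\<close>

lemma gauss_int_pderiv: "gauss_int (pderiv p) = 2 * gauss_int (pCons 0 p)"
proof -
  have monom: "gauss_int (pderiv (monom 1 k)) = 2 * gauss_int (pCons 0 (monom 1 k))" for k
  proof -
    have even: "gauss_int (monom 1 (2 * m)) = sqrt pi * (fact (2 * m) / (2 ^ (2 * m) * fact m))"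
      and odd: "gauss_int (monom 1 (Suc (2 * m))) = 0" for m
      using gauss_moment_even[of m] gauss_moment_odd[of m]
      by (simp_all add: gauss_int_def poly_monom has_bochner_integral_iff)
    have deriv: "pderiv (monom (1::real) k) = smult k (monom 1 (k - 1))"
      and shift: "pCons 0 (monom (1::real) k) = monom 1 (Suc k)"
      by (simp_all add: pderiv_monom smult_monom monom_Suc)
    show ?thesis
    proof (cases "even k")
      case True
      then obtain m where k: "k = 2 * m" by (elim evenE)
      show ?thesis
        \<comment> \<open>For \<open>m = 0\<close> the derivative is zero; otherwise it has the odd
          degree \<open>Suc (2 * (m - 1))\<close>.\<close>
        unfolding deriv shift gauss_int_smult
        using odd[of m] odd[of "m - 1"] by (cases m) (simp_all add: k)
    next
      case False
      then obtain m where k: "k = Suc (2 * m)" by (metis oddE Suc_eq_plus1)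
      have fact: "fact (2 * Suc m) = 2 * (real m + 1) * real k * fact (2 * m)"
          "fact (Suc m) = (real m + 1) * fact m" "2 ^ (2 * Suc m) = (4 :: real) * 2 ^ (2 * m)"
        by (simp_all add: k algebra_simps)
      have cancel: "2 * c * K * F / (4 * P * (c * G)) = K / 2 * (F / (P * G))"
        if "c \<noteq> 0" for c K F P G :: real
        using that by (simp add: mult_ac)
      have ratio: "fact (2 * Suc m) / (2 ^ (2 * Suc m) * fact (Suc m)) =
          real k / 2 * (fact (2 * m) / (2 ^ (2 * m) * fact m))"
        unfolding fact by (rule cancel) linarith
      have "gauss_int (monom 1 (2 * Suc m)) = real k / 2 * gauss_int (monom 1 (2 * m))"
        unfolding even ratio by (rule mult.left_commute)
      then show ?thesis
        unfolding deriv shift gauss_int_smult by (simp add: k)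
    qed
  qed
  have "gauss_int (pderiv (\<Sum>i\<le>degree p. smult (coeff p i) (monom 1 i)))
      = (\<Sum>i\<le>degree p. coeff p i * gauss_int (pderiv (monom 1 i)))"
    by (simp only: higher_pderiv_sum[where n = 1, simplified] pderiv_smult gauss_int_sum gauss_int_smult)
  also have "\<dots> = 2 * gauss_int (\<Sum>i\<le>degree p. smult (coeff p i) (pCons 0 (monom 1 i)))"
    by (simp only: monom gauss_int_sum gauss_int_smult sum_distrib_left mult_ac)
  also have "(\<Sum>i\<le>degree p. smult (coeff p i) (pCons 0 (monom 1 i)))
      = [:0, 1:] * (\<Sum>i\<le>degree p. smult (coeff p i) (monom 1 i))"
    by (simp add: sum_distrib_left)
  finally show ?thesis by (simp add: smult_monom poly_as_sum_of_monoms)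
qed

text \<open>The recursion for \<open>exp (- D\<^sup>2 / 4)\<close> is \<open>heat (z f) = (z - D / 2) (heat f)\<close>.\<close>

definition heat :: "real poly \<Rightarrow> real poly" where
  "heat f = fold_coeffs (\<lambda>c p. pCons c p - smult (1/2) (pderiv p)) f 0"

lemma heat_0 [simp]: "heat 0 = 0"
  by (simp add: heat_def)

lemma heat_pCons: "heat (pCons c f) = pCons c (heat f) - smult (1/2) (pderiv (heat f))"
  by (cases "c = 0 \<and> f = 0") (auto simp: heat_def)

lemma heat_add: "heat (f + g) = heat f + heat g"
  by (induction f g rule: poly_induct2)
     (simp_all add: heat_pCons pderiv_add smult_add_right smult_diff_right)

lemma heat_smult: "heat (smult c f) = smult c (heat f)"
  by (induction f) (simp_all add: heat_pCons pderiv_smult smult_diff_right mult.commute)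

lemma heat_sum: "heat (\<Sum>i\<in>A. f i) = (\<Sum>i\<in>A. heat (f i))"
  by (induction A rule: infinite_finite_induct) (simp_all add: heat_add)

lemma heat_pderiv: "heat (pderiv f) = pderiv (heat f)"
  by (induction f)
     (simp_all add: heat_pCons pderiv_pCons heat_add pderiv_diff pderiv_smult)

text \<open>In the recursion for \<open>heat\<close>, \<open>pderiv\<close> commutes with the
  translation, and multiplication by the variable changes only by the scalar \<open>t\<close>, which
  \<open>heat\<close> respects.\<close>

lemma heat_translate: "heat (pcompose f [:t, 1:]) = pcompose (heat f) [:t, 1:]"
proof (induction f)
  case (pCons c f)
  have "heat (pcompose (pCons c f) [:t, 1:]) =
      [:c:] + smult t (heat (pcompose f [:t, 1:])) + heat (pCons 0 (pcompose f [:t, 1:]))"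
    by (simp add: pcompose_pCons heat_add heat_smult heat_pCons)
  also have "\<dots> = pcompose (heat (pCons c f)) [:t, 1:]"
    by (simp add: heat_pCons pCons.IH pcompose_diff pcompose_smult pcompose_pCons
        pderiv_pcompose pderiv_pCons)
  finally show ?case .
qed simp

lemma surj_heat: "\<exists>f. heat f = p"
proof (induction p)
  case (pCons c p)
  then obtain f where "heat f = p" by auto
  \<comment> \<open>The preimage follows the recursion of the inverse operator
    \<open>exp (D^2 / 4)\<close>, in which the sign of the derivative term is reversed.\<close>
  then have "heat (pCons c f + smult (1/2) (pderiv f)) = pCons c p"
    by (simp add: heat_add heat_smult heat_pderiv heat_pCons)
  then show ?case by blast
qed (auto intro: heat_0)

text \<open>The derivative term lowers the degree, so it does not reach the top coefficient. A bound
  \<open>k\<close> in place of the exact degree lets degree and top coefficient go through one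
  induction.\<close>

lemma heat_degree_coeff:
  "degree f \<le> k \<Longrightarrow> degree (heat f) \<le> k \<and> coeff (heat f) k = coeff f k"
proof (induction f arbitrary: k)
  case (pCons c f)
  show ?case
  proof (cases "f = 0")
    case False
    with pCons.prems obtain l where k: "k = Suc l" "degree f \<le> l"
      by (cases k) auto
    then have *: "degree (heat f) \<le> l" "coeff (heat f) l = coeff f l"
      using pCons.IH by auto
    have "degree (pderiv (heat f)) \<le> l"
      using * degree_pderiv[of "heat f"] by simp
    then show ?thesis
      using * k by (auto simp: heat_pCons coeff_pCons coeff_eq_0 coeff_pderiv
          intro!: degree_diff_le order_trans[OF degree_pCons_le])
  qed (auto simp: heat_pCons coeff_pCons split: nat.splits)
qed simp

lemma degree_heat [simp]: "degree (heat f) = degree f"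
proof (cases "f = 0")
  case False
  then show ?thesis
    using heat_degree_coeff[of f "degree f"] by (metis antisym le_degree leading_coeff_0_iff order_refl)
qed simp

lemma lead_coeff_heat: "lead_coeff (heat f) = lead_coeff f"
  using heat_degree_coeff[of f "degree f"] by simp

lemma heat_eq_0_iff [simp]: "heat f = 0 \<longleftrightarrow> f = 0"
  using lead_coeff_heat[of f] by (metis heat_0 leading_coeff_0_iff)

section \<open>Hermite polynomials and their Gaussian inner products\<close>

definition hpoly :: "nat \<Rightarrow> real poly" where
  "hpoly k = heat (monom 1 k)"

lemma hpoly_0 [simp]: "hpoly 0 = 1"
  by (simp add: hpoly_def monom_0 heat_pCons one_pCons)

lemma hpoly_Suc: "hpoly (Suc k) = pCons 0 (hpoly k) - smult (1/2) (pderiv (hpoly k))"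
  by (simp add: hpoly_def monom_Suc heat_pCons)

lemma degree_hpoly [simp]: "degree (hpoly k) = k"
  by (simp add: hpoly_def degree_monom_eq)

lemma heat_eq_sum_hpoly: "heat f = (\<Sum>i\<le>degree f. smult (coeff f i) (hpoly i))"
  unfolding hpoly_def
  by (subst (1) poly_as_sum_of_monoms[symmetric]) (simp add: heat_sum smult_monom flip: heat_smult)

text \<open>Differentiating \<open>p * exp (- (x^2))\<close> turns \<open>p\<close> into
  \<open>-2 * (x * p - p' / 2)\<close>, which is the recursion \<open>hpoly_Suc\<close> up to the
  factor \<open>-2\<close>.\<close>

lemma hermite_monic_eq_poly: "hermite_monic m x = poly (hpoly m) x"
proof -
  have "(deriv ^^ m) (\<lambda>t. exp (- (t\<^sup>2))) = (\<lambda>x. (-2) ^ m * poly (hpoly m) x * exp (- (x\<^sup>2)))" for m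
  proof (induction m)
    case (Suc m)
    have "((\<lambda>x. (-2) ^ m * poly (hpoly m) x * exp (- (x\<^sup>2))) has_field_derivative
            (-2) ^ Suc m * poly (hpoly (Suc m)) x * exp (- (x\<^sup>2))) (at x)" for x :: real
      by (rule derivative_eq_intros refl poly_DERIV)+
         (simp add: hpoly_Suc algebra_simps)
    then show ?case by (auto simp: Suc.IH intro!: DERIV_imp_deriv)
  qed simp
  then show ?thesis
    by (simp add: hermite_monic_def exp_minus field_simps flip: power_mult_distrib)
qed

text \<open>For \<open>f = c + z * g\<close> the recursion gives
  \<open>c + z * heat g - (heat g)' / 2\<close>; integration by parts cancels the last two
  terms.\<close>

lemma gauss_int_heat: "gauss_int (heat f) = sqrt pi * coeff f 0"
proof (cases f)
  case (pCons c g)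
  have "gauss_int (heat f) = gauss_int ([:c:] + pCons 0 (heat g)) - gauss_int (pderiv (heat g)) / 2"
    by (simp add: pCons heat_pCons gauss_int_diff gauss_int_smult)
  then show ?thesis unfolding gauss_int_add gauss_int_pderiv by (simp add: pCons)
qed

text \<open>One integration by parts lowers \<open>hpoly (Suc q)\<close> to \<open>hpoly q\<close>
  and puts half a derivative on \<open>f\<close>; repeating this leaves the \<open>q\<close>-th
  Taylor coefficient of \<open>f\<close> at 0. For monomials \<open>f\<close> it is the
  orthogonality of the Hermite polynomials.\<close>

lemma gauss_int_hpoly_heat:
  "gauss_int (hpoly q * heat f) = sqrt pi * fact q / 2 ^ q * coeff f q"
proof (induction q arbitrary: f)
  case 0
  then show ?case by (simp add: gauss_int_heat)
next
  case (Suc q)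
  have "gauss_int (hpoly (Suc q) * heat f) =
      gauss_int (pCons 0 (hpoly q * heat f)) - gauss_int (pderiv (hpoly q) * heat f) / 2"
    by (simp add: hpoly_Suc left_diff_distrib gauss_int_diff gauss_int_smult)
  also have "\<dots> = gauss_int (pderiv (hpoly q * heat f) - pderiv (hpoly q) * heat f) / 2"
    by (simp add: gauss_int_diff gauss_int_pderiv)
  also have "pderiv (hpoly q * heat f) - pderiv (hpoly q) * heat f = hpoly q * heat (pderiv f)"
    by (simp add: pderiv_mult heat_pderiv)
  finally show ?case by (simp add: Suc.IH coeff_pderiv field_simps)
qed

lemma gauss_int_heat_heat:
  "gauss_int (heat g * heat f) = (\<Sum>q\<le>degree g. sqrt pi * fact q / 2 ^ q * coeff g q * coeff f q)"
  unfolding heat_eq_sum_hpoly[of g] sum_distrib_right gauss_int_sum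
  by (intro sum.cong) (simp_all add: gauss_int_smult gauss_int_hpoly_heat)


section \<open>Orders of vanishing and type II polynomials\<close>

lemma pcompose_power: "pcompose (p ^ k) q = pcompose p q ^ k"
  for p q :: "'a::comm_semiring_1 poly"
  by (induction k) (simp_all add: pcompose_1 pcompose_mult)

text \<open>Translation moves the zero \<open>t\<close> to 0, where the order of vanishing is
  visible in the coefficients.\<close>

lemma linear_power_dvd_iff_coeff_translate:
  "[:-t, 1:] ^ m dvd f \<longleftrightarrow> (\<forall>q<m. coeff (pcompose f [:t, 1:]) q = 0)" for t :: real
proof -
  have "monom 1 m dvd pcompose f [:t, 1:] \<longleftrightarrow> [:-t, 1:] ^ m dvd f"
  proof
    assume "[:-t, 1:] ^ m dvd f"
    then obtain g where "f = [:-t, 1:] ^ m * g" by (elim dvdE)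
    then have "pcompose f [:t, 1:] = monom 1 m * pcompose g [:t, 1:]"
      by (simp add: pcompose_mult pcompose_power pcompose_pCons monom_altdef)
    then show "monom 1 m dvd pcompose f [:t, 1:]" by simp
  next
    assume "monom 1 m dvd pcompose f [:t, 1:]"
    then obtain g where g: "pcompose f [:t, 1:] = monom 1 m * g" by (elim dvdE)
    have "f = pcompose (pcompose f [:t, 1:]) [:-t, 1:]"
      by (simp add: pcompose_pCons flip: pcompose_assoc)
    also have "\<dots> = [:-t, 1:] ^ m * pcompose g [:-t, 1:]"
      unfolding g by (simp add: pcompose_mult pcompose_power pcompose_pCons monom_altdef)
    finally show "[:-t, 1:] ^ m dvd f" by (metis dvd_triv_left)
  qed
  then show ?thesis by (simp add: monom_1_dvd_iff')
qed

lemma coprime_linear_powers: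
  fixes s t :: real
  assumes "s \<noteq> t"
  shows "coprime ([:-s, 1:] ^ k) ([:-t, 1:] ^ l)"
proof -
  have "coprime [:-s, 1:] [:-t, 1:]"
  proof (rule coprimeI)
    fix d assume "d dvd [:-s, 1:]" "d dvd [:-t, 1:]"
    then have "d dvd [:-s, 1:] - [:-t, 1:]" by (rule dvd_diff)
    also have "[:-s, 1:] - [:-t, 1:] = [:t - s:]" by simp
    also have "[:t - s:] dvd 1" using assms by (simp add: is_unit_const_poly_iff dvd_field_iff)
    finally show "d dvd 1" .
  qed
  then show ?thesis by simp
qed

section \<open>Integration against the weights\<close>

lemma has_bochner_integral_gauss_translate:
  "has_bochner_integral lborel (\<lambda>x. poly p x * exp (- ((x - t)\<^sup>2)))
     (gauss_int (pcompose p [:t, 1:]))"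
proof (subst lborel_has_bochner_integral_real_affine_iff[where c = 1 and t = t])
  show "has_bochner_integral lborel (\<lambda>x. poly p (t + 1 * x) * exp (- ((t + 1 * x - t)\<^sup>2)))
          (gauss_int (pcompose p [:t, 1:]) /\<^sub>R \<bar>1\<bar>)"
    using integrable_gauss_poly[of "pcompose p [:t, 1:]"]
    by (simp add: has_bochner_integral_iff gauss_int_def poly_pcompose)
qed simp

text \<open>Completing the square: the weight is a multiple of the Gaussian centred at
  \<open>node a j\<close>.\<close>

lemma weight_eq_gauss:
  "weight a j x = exp ((node a j)\<^sup>2) * exp (- ((x - node a j)\<^sup>2))"
  by (simp add: weight_def node_def power2_eq_square field_simps flip: exp_add)

lemma has_bochner_integral_weight:
  "has_bochner_integral lborel (\<lambda>x. poly p x * weight a j x)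
     (exp ((node a j)\<^sup>2) * gauss_int (pcompose p [:node a j, 1:]))"
  using has_bochner_integral_mult_right
    [OF has_bochner_integral_gauss_translate[of p "node a j"], of "exp ((node a j)\<^sup>2)"]
  by (simp add: weight_eq_gauss mult_ac)

text \<open>After translation to 0, \<open>gauss_int_heat_heat\<close> pairs coefficients of equal
  index. Those of the preimage of \<open>p\<close> stop below \<open>m\<close>, where those of
  \<open>f\<close> are zero. The case \<open>p = 0\<close> is separate because
  \<open>degree 0 = 0\<close> is not below \<open>m = 0\<close>.\<close>

lemma gauss_int_eq_0_if_vanishing:
  assumes "p = 0 \<or> degree p < m" and "\<forall>q<m. coeff (pcompose f [:t, 1:]) q = 0"
  shows "gauss_int (pcompose (p * heat f) [:t, 1:]) = 0"
proof -
  obtain g where g: "heat g = pcompose p [:t, 1:]" using surj_heat by blast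
  have "degree g = degree p" using degree_heat[of g] by (simp add: g degree_pcompose)
  then have "gauss_int (heat g * heat (pcompose f [:t, 1:])) = 0"
    using assms g unfolding gauss_int_heat_heat by (cases "p = 0") auto
  then show ?thesis by (simp add: g pcompose_mult heat_translate)
qed

lemma vanishing_if_gauss_int_eq_0:
  assumes "\<forall>k<m. gauss_int (pcompose (monom 1 k * heat f) [:t, 1:]) = 0" and "q < m"
  shows "coeff (pcompose f [:t, 1:]) q = 0"
proof -
  \<comment> \<open>Translation by \<open>t\<close> turns this polynomial into
    \<open>hpoly q\<close>, which isolates the \<open>q\<close>-th coefficient. Its degree is
    \<open>q < m\<close>, so only the given moments enter.\<close>
  let ?p = "pcompose (hpoly q) [:-t, 1:]"
  have "?p * heat f = (\<Sum>i\<le>degree ?p. smult (coeff ?p i) (monom 1 i)) * heat f"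
    by (simp add: smult_monom poly_as_sum_of_monoms del: degree_pcompose)
  also have "\<dots> = (\<Sum>i\<le>degree ?p. smult (coeff ?p i) (monom 1 i * heat f))"
    by (simp only: sum_distrib_right mult_smult_left)
  finally have sum: "?p * heat f = (\<Sum>i\<le>degree ?p. smult (coeff ?p i) (monom 1 i * heat f))" .
  have "gauss_int (pcompose (?p * heat f) [:t, 1:]) = 0"
    unfolding sum using assms
    by (auto simp: pcompose_sum pcompose_smult gauss_int_sum gauss_int_smult degree_pcompose
        intro!: sum.neutral)
  moreover have "pcompose ?p [:t, 1:] = hpoly q"
    by (simp add: pcompose_pCons flip: pcompose_assoc)
  ultimately have "gauss_int (hpoly q * heat (pcompose f [:t, 1:])) = 0"
    by (simp add: pcompose_mult heat_translate)
  then show ?thesis by (simp add: gauss_int_hpoly_heat)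
qed

section \<open>Prescribed zeros at the nodes and type II orthogonality\<close>

definition node_poly :: "nat \<Rightarrow> (nat \<Rightarrow> real) \<Rightarrow> (nat \<Rightarrow> nat) \<Rightarrow> real poly" where
  "node_poly r a m = (\<Prod>j=1..r. [:- node a j, 1:] ^ m j)"

lemma lead_coeff_node_poly: "lead_coeff (node_poly r a m) = 1"
  by (simp add: node_poly_def lead_coeff_prod lead_coeff_power)

lemma node_poly_neq_0 [simp]: "node_poly r a m \<noteq> 0"
  using lead_coeff_node_poly[of r a m] by auto

lemma degree_node_poly: "degree (node_poly r a m) = msize r m"
  by (simp add: node_poly_def msize_def degree_prod_eq_sum_degree degree_linear_power)

text \<open>Powers of linear factors at distinct nodes are coprime, so the local vanishing
  conditions combine into a single divisibility.\<close>

lemma node_poly_dvd_iff: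
  assumes "inj_on a {1..r}"
  shows "node_poly r a m dvd f \<longleftrightarrow>
           (\<forall>j\<in>{1..r}. \<forall>q<m j. coeff (pcompose f [:node a j, 1:]) q = 0)"
proof -
  have "(\<Prod>j\<in>J. [:- node a j, 1:] ^ m j) dvd f \<longleftrightarrow> (\<forall>j\<in>J. [:- node a j, 1:] ^ m j dvd f)"
    if "J \<subseteq> {1..r}" "finite J" for J
    using that(2,1)
  proof (induction J)
    case (insert i J)
    have cop: "coprime ([:- node a i, 1:] ^ m i) (\<Prod>j\<in>J. [:- node a j, 1:] ^ m j)"
    proof (rule prod_coprime_right, rule coprime_linear_powers)
      fix j assume "j \<in> J"
      then have "a i \<noteq> a j"
        using insert.hyps insert.prems inj_onD[OF assms, of i j] by blast
      then show "node a i \<noteq> node a j" by (simp add: node_def)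
    qed
    have "u * v dvd f \<longleftrightarrow> u dvd f \<and> v dvd f" if "coprime u v" for u v
      using that by (metis divides_mult dvd_mult_left dvd_mult_right)
    from this[OF cop] show ?case using insert by simp
  qed simp
  then show ?thesis by (simp add: node_poly_def linear_power_dvd_iff_coeff_translate)
qed

lemma coeff_translate_node_poly:
  assumes "inj_on a {1..r}" "j \<in> {1..r}" "q < m j"
  shows "coeff (pcompose (node_poly r a m) [:node a j, 1:]) q = 0"
  using node_poly_dvd_iff[OF assms(1), of m "node_poly r a m"] dvd_refl assms(2,3) by blast

text \<open>For the preimage of \<open>P\<close> under \<open>heat\<close>, orthogonality to the
  weights means divisibility by \<open>node_poly\<close>. The degrees agree and both are monic, so
  the quotient is 1.\<close>

lemma is_type_II_weight_iff:
  assumes "inj_on a {1..r}"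
  shows "is_type_II r (weight a) m P \<longleftrightarrow> P = heat (node_poly r a m)"
proof -
  obtain f where f: "heat f = P" using surj_heat by blast
  have "has_bochner_integral lborel (\<lambda>x. poly P x * x ^ k * weight a j x) 0 \<longleftrightarrow>
        gauss_int (pcompose (monom 1 k * heat f) [:node a j, 1:]) = 0" for j k
    using has_bochner_integral_weight[of "monom 1 k * heat f" a j]
    by (auto simp: f poly_monom has_bochner_integral_iff mult_ac)
  then have "(\<forall>k<m j. has_bochner_integral lborel (\<lambda>x. poly P x * x ^ k * weight a j x) 0) \<longleftrightarrow>
        (\<forall>q<m j. coeff (pcompose f [:node a j, 1:]) q = 0)" for j
    using vanishing_if_gauss_int_eq_0[of "m j" f "node a j"]
      gauss_int_eq_0_if_vanishing[of _ "m j" f "node a j"]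
    by (auto simp: degree_monom_eq)
  then have "is_type_II r (weight a) m P \<longleftrightarrow>
      lead_coeff f = 1 \<and> degree f = msize r m \<and> node_poly r a m dvd f"
    unfolding is_type_II_def node_poly_dvd_iff[OF assms]
    by (simp add: lead_coeff_heat[unfolded degree_heat] flip: f)
  also have "\<dots> \<longleftrightarrow> f = node_poly r a m"
  proof safe
    assume lc: "lead_coeff f = 1" and deg: "degree f = msize r m" and "node_poly r a m dvd f"
    then obtain g where g: "f = node_poly r a m * g" by (elim dvdE)
    with lc have "lead_coeff g = 1" by (simp add: lead_coeff_mult lead_coeff_node_poly)
    moreover from this have "g \<noteq> 0" by auto
    with deg have "degree g = 0" by (simp add: g degree_mult_eq degree_node_poly)
    then obtain c where "g = [:c:]" by (rule degree_eq_zeroE)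
    ultimately have "g = 1" by (simp add: one_pCons)
    then show "f = node_poly r a m" by (simp add: g)
  qed (use lead_coeff_node_poly[of r a m] in \<open>simp_all add: degree_node_poly\<close>)
  also have "\<dots> \<longleftrightarrow> P = heat (node_poly r a m)"
  proof -
    have "heat (f - node_poly r a m) = P - heat (node_poly r a m)"
      using heat_add[of "f - node_poly r a m" "node_poly r a m"] by (simp add: f)
    then show ?thesis by (metis eq_iff_diff_eq_0 heat_eq_0_iff)
  qed
  finally show ?thesis .
qed

lemma type_II_weight:
  assumes "inj_on a {1..r}"
  shows "type_II r (weight a) m = heat (node_poly r a m)"
  unfolding type_II_def is_type_II_weight_iff[OF assms] by simp


section \<open>The space of linear forms\<close>

definition form_space :: "nat \<Rightarrow> (nat \<Rightarrow> real) \<Rightarrow> (nat \<Rightarrow> nat) \<Rightarrow> (real \<Rightarrow> real) set" where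
  "form_space r a m = {Q. \<exists>A. (\<forall>j\<in>{1..r}. A j = 0 \<or> degree (A j) < m j) \<and>
     Q = (\<lambda>x. \<Sum>j=1..r. poly (A j) x * weight a j x)}"

text \<open>A Bochner integral defaults to 0 where the integrand is not integrable, so additivity
  below is stated for members of \<open>form_space\<close>.\<close>

definition pairing :: "(real \<Rightarrow> real) \<Rightarrow> real poly \<Rightarrow> real" where
  "pairing Q p = (LINT x|lborel. Q x * poly p x)"

lemma has_bochner_integral_form:
  "has_bochner_integral lborel (\<lambda>x. (\<Sum>j=1..r. poly (A j) x * weight a j x) * poly p x)
     (\<Sum>j=1..r. exp ((node a j)\<^sup>2) * gauss_int (pcompose (A j * p) [:node a j, 1:]))"
proof -
  have "has_bochner_integral lborel (\<lambda>x. \<Sum>j=1..r. poly (A j * p) x * weight a j x)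
     (\<Sum>j=1..r. exp ((node a j)\<^sup>2) * gauss_int (pcompose (A j * p) [:node a j, 1:]))"
    by (intro has_bochner_integral_sum has_bochner_integral_weight)
  also have "(\<lambda>x. \<Sum>j=1..r. poly (A j * p) x * weight a j x) =
      (\<lambda>x. (\<Sum>j=1..r. poly (A j) x * weight a j x) * poly p x)"
    unfolding sum_distrib_right by (simp add: mult_ac)
  finally show ?thesis .
qed

lemma form_space_integrable:
  "Q \<in> form_space r a m \<Longrightarrow> integrable lborel (\<lambda>x. Q x * poly p x)"
  unfolding form_space_def using has_bochner_integral_form has_bochner_integral_iff by blast

lemma form_space_mono:
  assumes "Q \<in> form_space r a m" "\<And>j. j \<in> {1..r} \<Longrightarrow> m j \<le> m' j"
  shows "Q \<in> form_space r a m'"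
proof -
  from assms(1) obtain A where
    "\<forall>j\<in>{1..r}. A j = 0 \<or> degree (A j) < m j" "Q = (\<lambda>x. \<Sum>j=1..r. poly (A j) x * weight a j x)"
    unfolding form_space_def by auto
  then show ?thesis
    unfolding form_space_def using assms(2)
    by (intro CollectI exI[of _ A]) (meson less_le_trans)
qed

lemma form_space_0 [simp]: "(\<lambda>_. 0) \<in> form_space r a m"
  unfolding form_space_def by (auto intro!: exI[of _ "\<lambda>_. 0"])

lemma form_space_add:
  assumes "Q \<in> form_space r a m" "R \<in> form_space r a m"
  shows "(\<lambda>x. Q x + R x) \<in> form_space r a m"
proof -
  from assms obtain A B where
    "\<forall>j\<in>{1..r}. A j = 0 \<or> degree (A j) < m j" "Q = (\<lambda>x. \<Sum>j=1..r. poly (A j) x * weight a j x)"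
    "\<forall>j\<in>{1..r}. B j = 0 \<or> degree (B j) < m j" "R = (\<lambda>x. \<Sum>j=1..r. poly (B j) x * weight a j x)"
    unfolding form_space_def by auto
  then show ?thesis
    unfolding form_space_def
    by (intro CollectI exI[of _ "\<lambda>j. A j + B j"])
       (fastforce simp: sum.distrib distrib_right intro: degree_add_less)
qed

lemma form_space_cmult:
  assumes "Q \<in> form_space r a m"
  shows "(\<lambda>x. c * Q x) \<in> form_space r a m"
proof -
  from assms obtain A where
    "\<forall>j\<in>{1..r}. A j = 0 \<or> degree (A j) < m j" "Q = (\<lambda>x. \<Sum>j=1..r. poly (A j) x * weight a j x)"
    unfolding form_space_def by auto
  then show ?thesis
    unfolding form_space_def
    by (intro CollectI exI[of _ "\<lambda>j. smult c (A j)"])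
       (auto simp: sum_distrib_left mult_ac intro: le_less_trans[OF degree_smult_le])
qed

lemma form_space_diff:
  assumes "Q \<in> form_space r a m" "R \<in> form_space r a m"
  shows "(\<lambda>x. Q x - R x) \<in> form_space r a m"
  using form_space_add[OF assms(1) form_space_cmult[OF assms(2), of "-1"]] by simp

lemma form_space_sum:
  assumes "\<And>i. i \<in> I \<Longrightarrow> Q i \<in> form_space r a m"
  shows "(\<lambda>x. \<Sum>i\<in>I. Q i x) \<in> form_space r a m"
  using assms by (induction I rule: infinite_finite_induct) (auto intro: form_space_add)

lemma form_space_weight:
  assumes "j \<in> {1..r}" "degree p < m j"
  shows "(\<lambda>x. poly p x * weight a j x) \<in> form_space r a m"
  unfolding form_space_def
proof (intro CollectI exI[of _ "\<lambda>i. if i = j then p else 0"] conjI ext)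
  fix x
  have "(\<Sum>i=1..r. poly (if i = j then p else 0) x * weight a i x) =
      (\<Sum>i=1..r. if i = j then poly p x * weight a j x else 0)"
    by (intro sum.cong) auto
  then show "poly p x * weight a j x =
      (\<Sum>i=1..r. poly (if i = j then p else 0) x * weight a i x)"
    using assms by simp
qed (use assms in auto)

section \<open>Linearity and vanishing of the pairing\<close>

lemma pairing_add_left:
  assumes "Q \<in> form_space r a m" "R \<in> form_space r a m"
  shows "pairing (\<lambda>x. Q x + R x) p = pairing Q p + pairing R p"
  unfolding pairing_def using assms by (simp add: distrib_right form_space_integrable)

lemma pairing_cmult_left: "pairing (\<lambda>x. c * Q x) p = c * pairing Q p"
  by (simp add: pairing_def mult.assoc)

lemma pairing_diff_left:
  assumes "Q \<in> form_space r a m" "R \<in> form_space r a m"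
  shows "pairing (\<lambda>x. Q x - R x) p = pairing Q p - pairing R p"
  unfolding pairing_def using assms by (simp add: left_diff_distrib form_space_integrable)

lemma pairing_sum_left:
  assumes "\<And>i. i \<in> I \<Longrightarrow> Q i \<in> form_space r a m"
  shows "pairing (\<lambda>x. \<Sum>i\<in>I. Q i x) p = (\<Sum>i\<in>I. pairing (Q i) p)"
  unfolding pairing_def sum_distrib_right
  by (intro Bochner_Integration.integral_sum form_space_integrable[of _ r a m] assms)

lemma pairing_add_right:
  assumes "Q \<in> form_space r a m"
  shows "pairing Q (p + q) = pairing Q p + pairing Q q"
  unfolding pairing_def using assms by (simp add: distrib_left form_space_integrable)

lemma pairing_smult_right: "pairing Q (smult c p) = c * pairing Q p"
  by (simp add: pairing_def mult.left_commute)

lemma pairing_sum_right: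
  assumes "Q \<in> form_space r a m"
  shows "pairing Q (\<Sum>i\<in>I. p i) = (\<Sum>i\<in>I. pairing Q (p i))"
  by (induction I rule: infinite_finite_induct)
     (simp_all add: pairing_add_right[OF assms], simp_all add: pairing_def)

lemma pairing_eq_sum_monom:
  assumes "Q \<in> form_space r a m"
  shows "pairing Q p = (\<Sum>i\<le>degree p. coeff p i * pairing Q (monom 1 i))"
proof -
  have "pairing Q (\<Sum>i\<le>degree p. smult (coeff p i) (monom 1 i)) =
      (\<Sum>i\<le>degree p. coeff p i * pairing Q (monom 1 i))"
    by (simp only: pairing_sum_right[OF assms] pairing_smult_right)
  then show ?thesis by (simp add: smult_monom poly_as_sum_of_monoms)
qed

lemma pairing_heat_eq_sum_hpoly:
  assumes "Q \<in> form_space r a m"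
  shows "pairing Q (heat f) = (\<Sum>i\<le>degree f. coeff f i * pairing Q (hpoly i))"
  by (simp only: heat_eq_sum_hpoly pairing_sum_right[OF assms] pairing_smult_right)

text \<open>At each node the order of vanishing exceeds the degree of the coefficient of the form
  there, so every summand is zero. The kernel recursion uses this to see that the earlier terms
  annihilate the next type II polynomial.\<close>

lemma pairing_node_poly_eq_0:
  assumes "inj_on a {1..r}" "Q \<in> form_space r a m"
    and "\<And>j. j \<in> {1..r} \<Longrightarrow> m j \<le> m' j"
  shows "pairing Q (heat (node_poly r a m')) = 0"
proof -
  obtain A where A: "\<forall>j\<in>{1..r}. A j = 0 \<or> degree (A j) < m j"
    "Q = (\<lambda>x. \<Sum>j=1..r. poly (A j) x * weight a j x)"
    using assms(2) unfolding form_space_def by auto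
  have van: "\<forall>j\<in>{1..r}. \<forall>q<m' j. coeff (pcompose (node_poly r a m') [:node a j, 1:]) q = 0"
    by (blast intro: coeff_translate_node_poly[OF assms(1)])
  have "gauss_int (pcompose (A j * heat (node_poly r a m')) [:node a j, 1:]) = 0"
    if "j \<in> {1..r}" for j
    using that A van assms(3)[OF that] by (intro gauss_int_eq_0_if_vanishing[of _ "m j"]) auto
  then show ?thesis
    using has_bochner_integral_form[where r = r and A = A and a = a and p = "heat (node_poly r a m')"]
    by (simp add: pairing_def A(2) has_bochner_integral_iff)
qed

lemma msize_fun_upd:
  assumes "J \<in> {1..r}"
  shows "msize r (m(J := d)) + m J = msize r m + d"
proof -
  have "(\<Sum>j\<in>{1..r} - {J}. (m(J := d)) j) = (\<Sum>j\<in>{1..r} - {J}. m j)"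
    by (intro sum.cong) auto
  then show ?thesis
    unfolding msize_def using sum.remove[OF _ assms, of m] sum.remove[OF _ assms, of "m(J := d)"]
    by simp
qed

text \<open>The form is tested against the polynomial that vanishes to order \<open>m j\<close> at all nodes but one,
  and at that node to an order equal to the degree of the coefficient there.\<close>

lemma form_space_nondegenerate:
  assumes inj: "inj_on a {1..r}" and "Q \<in> form_space r a m"
    and orth: "\<And>f. degree f < msize r m \<Longrightarrow> pairing Q (heat f) = 0"
  shows "Q x = 0"
proof -
  obtain A where A: "\<forall>j\<in>{1..r}. A j = 0 \<or> degree (A j) < m j"
    "Q = (\<lambda>x. \<Sum>j=1..r. poly (A j) x * weight a j x)"
    using assms(2) unfolding form_space_def by auto
  have "A J = 0" if J: "J \<in> {1..r}" for J
  proof (rule ccontr)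
    assume "A J \<noteq> 0"
    define d where "d = degree (A J)"
    have d: "d < m J" using A J \<open>A J \<noteq> 0\<close> by (auto simp: d_def)
    obtain g where g: "heat g = pcompose (A J) [:node a J, 1:]" using surj_heat by blast
    have deg_g: "degree g = d" using degree_heat[of g] by (simp add: g degree_pcompose d_def)
    have "g \<noteq> 0"
      using \<open>A J \<noteq> 0\<close> g heat_eq_0_iff[of g] by (auto simp: pcompose_eq_0_iff)
    define f where "f = node_poly r a (m(J := d))"
    have van: "\<forall>j\<in>{1..r}. \<forall>q<(m(J := d)) j. coeff (pcompose f [:node a j, 1:]) q = 0"
      unfolding f_def by (blast intro: coeff_translate_node_poly[OF inj])
    have deg_f: "degree f + m J = msize r m + d"
      unfolding f_def degree_node_poly using msize_fun_upd[OF J] by simp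
    \<comment> \<open>One more order of vanishing at node \<open>J\<close> would make
      \<open>f\<close> divisible by a polynomial of degree \<open>degree f + 1\<close>.\<close>
    have nz: "coeff (pcompose f [:node a J, 1:]) d \<noteq> 0"
    proof
      assume "coeff (pcompose f [:node a J, 1:]) d = 0"
      with van have "\<forall>j\<in>{1..r}. \<forall>q<(m(J := Suc d)) j. coeff (pcompose f [:node a j, 1:]) q = 0"
        by (auto simp: less_Suc_eq)
      then have "node_poly r a (m(J := Suc d)) dvd f" by (simp add: node_poly_dvd_iff[OF inj])
      then have "degree (node_poly r a (m(J := Suc d))) \<le> degree f"
        by (rule dvd_imp_degree_le) (simp add: f_def)
      then show False
        using deg_f msize_fun_upd[OF J, of m "Suc d"] by (simp add: degree_node_poly)
    qed
    have "gauss_int (pcompose (A j * heat f) [:node a j, 1:]) = 0" if "j \<in> {1..r} - {J}" for j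
      using that A van by (intro gauss_int_eq_0_if_vanishing[of _ "m j"]) auto
    note zero = this
    have "pairing Q (heat f) =
        (\<Sum>j=1..r. exp ((node a j)\<^sup>2) * gauss_int (pcompose (A j * heat f) [:node a j, 1:]))"
      using has_bochner_integral_form[where r = r and A = A and a = a and p = "heat f"]
      by (simp add: pairing_def A(2) has_bochner_integral_iff)
    also have "\<dots> =
        (\<Sum>j\<in>{J}. exp ((node a j)\<^sup>2) * gauss_int (pcompose (A j * heat f) [:node a j, 1:]))"
      using J zero by (intro sum.mono_neutral_right) auto
    also have "\<dots> = exp ((node a J)\<^sup>2) * gauss_int (pcompose (A J * heat f) [:node a J, 1:])"
      by simp
    also have "pcompose (A J * heat f) [:node a J, 1:] = heat g * heat (pcompose f [:node a J, 1:])"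
      by (simp add: pcompose_mult g heat_translate)
    \<comment> \<open>Only index \<open>d\<close> survives: \<open>f\<close> vanishes to order
      \<open>d\<close> at this node, and \<open>g\<close> has degree \<open>d\<close>.\<close>
    also have "gauss_int \<dots> =
        (\<Sum>q\<in>{d}. sqrt pi * fact q / 2 ^ q * coeff g q * coeff (pcompose f [:node a J, 1:]) q)"
      unfolding gauss_int_heat_heat deg_g
      using van J by (intro sum.mono_neutral_right) (auto simp: le_less)
    finally have "pairing Q (heat f) \<noteq> 0" using nz \<open>g \<noteq> 0\<close> deg_g by auto
    moreover have "degree f < msize r m" using deg_f d by linarith
    ultimately show False using orth by blast
  qed
  then show ?thesis by (simp add: A(2))
qed


section \<open>Hermite interpolation\<close>

lemma higher_deriv_eq_fps_nth:
  fixes f :: "real \<Rightarrow> real"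
  assumes "f has_fps_expansion F"
  shows "(deriv ^^ k) f 0 = fact k * fps_nth F k"
proof -
  let ?R = "fps_conv_radius F"
  have radius: "?R \<le> fps_conv_radius ((fps_deriv ^^ k) F)" for k
    by (induction k) (auto intro: order_trans fps_conv_radius_deriv)
  \<comment> \<open>The claim covers the whole disc of convergence, since the induction step
    differentiates it and needs it on a neighbourhood.\<close>
  have "(deriv ^^ k) (eval_fps F) z = eval_fps ((fps_deriv ^^ k) F) z" if "z \<in> eball 0 ?R" for z
    using that
  proof (induction k arbitrary: z)
    case (Suc k)
    have "eventually (\<lambda>w. w \<in> eball 0 ?R) (nhds z)"
      using Suc.prems by (intro eventually_nhds_in_open) auto
    then have "deriv ((deriv ^^ k) (eval_fps F)) z = deriv (eval_fps ((fps_deriv ^^ k) F)) z"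
      by (intro deriv_cong_ev) (auto elim!: eventually_mono simp: Suc.IH)
    then show ?case
      using Suc.prems radius[of k] by (simp add: eval_fps_deriv in_eball_iff less_le_trans)
  qed simp
  moreover have "(0::real) \<in> eball 0 ?R"
    using assms by (auto simp: has_fps_expansion_def zero_ereal_def)
  \<comment> \<open>\<open>f\<close> agrees with its power series only near 0, which suffices for
    derivatives at 0.\<close>
  moreover have "(deriv ^^ k) (eval_fps F) 0 = (deriv ^^ k) f 0"
    using assms by (intro higher_deriv_cong_ev) (auto simp: has_fps_expansion_def)
  ultimately show ?thesis
    by (simp add: eval_fps_at_0 fps_0th_higher_deriv)
qed

text \<open>The sum is the Taylor polynomial of \<open>1 / L\<close> at \<open>t\<close>. Truncating
  the series at \<open>M\<close> does not affect the product's coefficients below \<open>M\<close>,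
  which are therefore those of \<open>F * inverse F = 1\<close>.\<close>

lemma coeff_mult_taylor_inverse:
  fixes L :: "real poly"
  assumes "poly L t \<noteq> 0" "q < M"
  shows "coeff (pcompose (L * (\<Sum>\<mu><M. smult (1 / fact \<mu> * (deriv ^^ \<mu>) (\<lambda>z. 1 / poly L z) t)
           ([:-t, 1:] ^ \<mu>))) [:t, 1:]) q = (if q = 0 then 1 else 0)"
proof -
  define G where "G = pcompose L [:t, 1:]"
  define F where "F = fps_of_poly G"
  have "poly G has_fps_expansion F"
    by (simp add: has_fps_expansion_def F_def)
  moreover have F0: "fps_nth F 0 \<noteq> 0"
    using assms(1) by (simp add: F_def G_def)
  ultimately have "(\<lambda>x. inverse (poly G x)) has_fps_expansion inverse F"
    by (rule has_fps_expansion_inverse)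
  moreover have "(\<lambda>x. inverse (poly G x)) = (\<lambda>z. 1 / poly L z) \<circ> (\<lambda>x. t + x)"
    by (simp add: fun_eq_iff G_def poly_pcompose inverse_eq_divide)
  ultimately have deriv: "(deriv ^^ \<mu>) (\<lambda>z. 1 / poly L z) t = fact \<mu> * fps_nth (inverse F) \<mu>" for \<mu>
    by (subst higher_deriv_shift_0) (simp add: higher_deriv_eq_fps_nth)
  define S where "S = (\<Sum>\<mu><M. monom (fps_nth (inverse F) \<mu>) \<mu>)"
  have S: "coeff S i = fps_nth (inverse F) i" if "i < M" for i
    using that by (simp add: S_def coeff_sum)
  have "pcompose (L * (\<Sum>\<mu><M. smult (1 / fact \<mu> * (deriv ^^ \<mu>) (\<lambda>z. 1 / poly L z) t)
           ([:-t, 1:] ^ \<mu>))) [:t, 1:] = G * S"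
    by (simp add: deriv G_def S_def pcompose_mult pcompose_sum pcompose_smult pcompose_power
        pcompose_pCons monom_altdef)
  also have "coeff (G * S) q = fps_nth (F * inverse F) q"
    using assms(2) by (auto simp: coeff_mult fps_mult_nth F_def S atMost_atLeast0 intro!: sum.cong)
  also have "F * inverse F = 1"
    using F0 by (simp add: inverse_mult_eq_1')
  finally show ?thesis by simp
qed

text \<open>These are the basis polynomials of Hermite interpolation. At node \<open>j\<close> the
  factor \<open>L_poly\<close> is cancelled by its truncated reciprocal, leaving
  \<open>(z - t)^q / q!\<close> up to order \<open>n j\<close>; at every other node
  \<open>L_poly\<close> vanishes to the full order.\<close>

lemma coeff_translate_interp_poly:
  assumes "inj_on a {1..r}" "a 1 = 0" "j \<in> {2..r}" "q < n j" "i \<in> {1..r}" "p < n i"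
  shows "coeff (pcompose (interp_poly r a n j q) [:node a i, 1:]) p =
           (if i = j \<and> p = q then 1 / fact q else 0)"
proof (cases "i = j")
  case True
  let ?t = "node a j" and ?L = "L_poly r a n j"
  define H where "H = pcompose (?L * (\<Sum>\<mu><n j - q. smult (1 / fact \<mu> *
      (deriv ^^ \<mu>) (\<lambda>z. 1 / poly ?L z) ?t) ([:- ?t, 1:] ^ \<mu>))) [:?t, 1:]"
  have neq: "a j \<noteq> a k" if "k \<in> {1..r}" "k \<noteq> j" for k
    using that assms(3) inj_onD[OF assms(1), of j k] by auto
  \<comment> \<open>Since \<open>a 1 = 0\<close>, distinctness keeps node \<open>j\<close> away from
    0, so the denominators in \<open>L_poly\<close> are nonzero.\<close>
  have "a j \<noteq> 0" using neq[of 1] assms(2,3) by auto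
  then have "poly ?L ?t \<noteq> 0"
    using neq by (auto simp: poly_L_poly node_def)
  then have H: "coeff H k = (if k = 0 then 1 else 0)" if "k < n j - q" for k
    unfolding H_def using that by (rule coeff_mult_taylor_inverse)
  have "interp_poly r a n j q = smult (1 / fact q) ([:- ?t, 1:] ^ q) * (?L *
      (\<Sum>\<mu><n j - q. smult (1 / fact \<mu> * (deriv ^^ \<mu>) (\<lambda>z. 1 / poly ?L z) ?t) ([:- ?t, 1:] ^ \<mu>)))"
    unfolding interp_poly_def by (simp only: mult_ac)
  then have "pcompose (interp_poly r a n j q) [:?t, 1:] =
      smult (1 / fact q) (monom 1 q) * H"
    by (simp only: H_def pcompose_mult[of "smult _ _"] pcompose_smult pcompose_power monom_altdef)
       (simp add: pcompose_pCons)
  then show ?thesis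
    using assms(6) True by (simp add: coeff_monom_mult H)
next
  case False
  have dvd: "p ^ k dvd smult c p ^ k" for p :: "real poly" and c k
    by (intro dvd_power_same dvd_smult dvd_refl)
  have "[:- node a i, 1:] ^ n i dvd L_poly r a n j"
  proof (cases "i = 1")
    case True
    then have "[:- node a i, 1:] ^ n i = [:0, 1:] ^ n 1"
      using assms(2) by (simp add: node_def)
    then show ?thesis unfolding L_poly_def by (simp only: dvd_mult2 dvd)
  next
    case i: False
    then have "smult (1 / (node a j - node a i)) [:- node a i, 1:] ^ n i dvd
        (\<Prod>i\<in>{2..r} - {j}. smult (1 / (node a j - node a i)) [:- node a i, 1:] ^ n i)"
      using False assms(5) by (intro dvd_prodI) auto
    with dvd show ?thesis
      unfolding L_poly_def by (blast intro: dvd_mult dvd_trans)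
  qed
  then have "[:- node a i, 1:] ^ n i dvd interp_poly r a n j q"
    unfolding interp_poly_def by (intro dvd_mult2)
  then show ?thesis
    using False assms(6) by (simp add: linear_power_dvd_iff_coeff_translate)
qed

text \<open>The hypothesis on low coefficients prescribes zero data at the first node 0, so the sum
  starts at \<open>j = 2\<close>. A nonzero error would be divisible by \<open>node_poly\<close>,
  whose degree is too large.\<close>

lemma hermite_interpolation:
  assumes "inj_on a {1..r}" "a 1 = 0" "degree f < msize r n" "\<And>q. q < n 1 \<Longrightarrow> coeff f q = 0"
  shows "f = (\<Sum>j=2..r. \<Sum>q<n j. smult (fact q * coeff (pcompose f [:node a j, 1:]) q)
               (interp_poly r a n j q))"
    (is "f = ?g")
proof (rule ccontr)
  assume "f \<noteq> ?g"
  then have "f - ?g \<noteq> 0" by simp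
  have "degree ?g < msize r n"
    using assms(3) by (intro degree_sum_less) (auto intro!: le_less_trans[OF degree_smult_le] degree_interp_poly)
  then have "degree (f - ?g) < msize r n"
    using assms(3) by (intro degree_diff_less)
  moreover have "node_poly r a n dvd f - ?g"
    unfolding node_poly_dvd_iff[OF assms(1)]
  proof (intro ballI allI impI)
    fix i p assume i: "i \<in> {1..r}" and p: "p < n i"
    have "coeff (pcompose ?g [:node a i, 1:]) p = (\<Sum>j=2..r. \<Sum>q<n j.
        fact q * coeff (pcompose f [:node a j, 1:]) q * (if i = j \<and> p = q then 1 / fact q else 0))"
      unfolding pcompose_sum coeff_sum pcompose_smult coeff_smult
      by (intro sum.cong refl) (subst coeff_translate_interp_poly[where i = i and p = p and n = n and a = a and r = r,
            OF assms(1,2) _ _ i p], auto)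
    also have "\<dots> = (\<Sum>j=2..r. if i = j then coeff (pcompose f [:node a j, 1:]) p else 0)"
    proof (intro sum.cong refl)
      fix j assume "j \<in> {2..r}"
      have "(\<Sum>q<n j. fact q * coeff (pcompose f [:node a j, 1:]) q *
            (if i = j \<and> p = q then 1 / fact q else 0)) =
          (\<Sum>q<n j. if p = q then (if i = j then coeff (pcompose f [:node a j, 1:]) q else 0) else 0)"
        by (intro sum.cong) auto
      then show "(\<Sum>q<n j. fact q * coeff (pcompose f [:node a j, 1:]) q *
            (if i = j \<and> p = q then 1 / fact q else 0)) =
          (if i = j then coeff (pcompose f [:node a j, 1:]) p else 0)"
        using p by auto
    qed
    \<comment> \<open>For \<open>i = 1\<close> no summand matches and the node is 0, so the right
      side vanishes by the hypothesis on low coefficients.\<close>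
    also have "\<dots> = coeff (pcompose f [:node a i, 1:]) p"
      using i p assms(2,4) by (cases "i = 1") (auto simp: node_def)
    finally show "coeff (pcompose (f - ?g) [:node a i, 1:]) p = 0"
      by (simp add: pcompose_diff)
  qed
  then have "degree (node_poly r a n) \<le> degree (f - ?g)"
    using \<open>f - ?g \<noteq> 0\<close> by (rule dvd_imp_degree_le)
  ultimately show False unfolding degree_node_poly by linarith
qed


section \<open>The dual basis\<close>

text \<open>The form that represents \<open>heat f \<mapsto> (d/dz)\<^sup>q f\<close> at \<open>node a j\<close>.\<close>

definition taylor_form :: "(nat \<Rightarrow> real) \<Rightarrow> nat \<Rightarrow> nat \<Rightarrow> real \<Rightarrow> real" where
  "taylor_form a j q y = 2 ^ q / sqrt pi * exp (- (node a j)\<^sup>2) *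
     (poly (pcompose (hpoly q) [:- node a j, 1:]) y * weight a j y)"

lemma taylor_form_in_form_space:
  assumes "j \<in> {1..r}" "q < m j"
  shows "taylor_form a j q \<in> form_space r a m"
  unfolding taylor_form_def using assms
  by (intro form_space_cmult form_space_weight) (auto simp: degree_pcompose)

text \<open>The prefactor of \<open>taylor_form\<close> cancels the constant from completing the
  square and the one in \<open>gauss_int_hpoly_heat\<close>, up to \<open>fact q\<close>.\<close>

lemma pairing_taylor_form:
  "pairing (taylor_form a j q) (heat f) = fact q * coeff (pcompose f [:node a j, 1:]) q"
proof -
  let ?t = "node a j" and ?p = "pcompose (hpoly q) [:- node a j, 1:]"
  have "pcompose (?p * heat f) [:?t, 1:] = hpoly q * heat (pcompose f [:?t, 1:])"
    by (simp add: pcompose_mult heat_translate pcompose_pCons flip: pcompose_assoc)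
  then have "pairing (\<lambda>y. poly ?p y * weight a j y) (heat f) =
      exp (?t\<^sup>2) * (sqrt pi * fact q / 2 ^ q * coeff (pcompose f [:?t, 1:]) q)"
    using has_bochner_integral_weight[of "?p * heat f" a j]
    by (simp add: pairing_def has_bochner_integral_iff gauss_int_hpoly_heat mult_ac)
  then show ?thesis
    unfolding taylor_form_def pairing_cmult_left by (simp add: exp_minus)
qed

text \<open>For \<open>k >= n 1\<close> the first sum reads off the coefficient of
  \<open>z^k\<close> in the Hermite interpolant. It is correct on \<open>hpoly l\<close> for
  \<open>n 1 <= l < msize r n\<close>; for \<open>l < n 1\<close> it gives \<open>Gammacoef\<close>,
  which the second sum removes.\<close>

definition dual_form ::
    "nat \<Rightarrow> (nat \<Rightarrow> real) \<Rightarrow> (nat \<Rightarrow> nat) \<Rightarrow> nat \<Rightarrow> real \<Rightarrow> real" where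
  "dual_form r a n k y =
     (if k < n 1 then 1 / fact k * taylor_form a 1 k y
      else (\<Sum>j=2..r. \<Sum>q<n j. vcoef r a n j q (k - n 1) * taylor_form a j q y)
         - (\<Sum>m<n 1. Gammacoef r a n m (k - n 1) / fact m * taylor_form a 1 m y))"

lemma dual_form_low: "k < n 1 \<Longrightarrow> dual_form r a n k = (\<lambda>y. 1 / fact k * taylor_form a 1 k y)"
  by (simp add: dual_form_def fun_eq_iff)

lemma dual_form_high:
  "\<not> k < n 1 \<Longrightarrow> dual_form r a n k = (\<lambda>y.
     (\<Sum>j=2..r. \<Sum>q<n j. vcoef r a n j q (k - n 1) * taylor_form a j q y)
     - (\<Sum>m<n 1. Gammacoef r a n m (k - n 1) / fact m * taylor_form a 1 m y))"
  by (simp add: dual_form_def fun_eq_iff)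

lemma dual_form_in_form_space:
  assumes "r \<ge> 1"
  shows "dual_form r a n k \<in> form_space r a n"
proof (cases "k < n 1")
  case True
  then show ?thesis
    unfolding dual_form_low[of k n r a, OF True] using assms
    by (intro form_space_cmult taylor_form_in_form_space) auto
next
  case False
  then show ?thesis
    unfolding dual_form_high[of k n r a, OF False] using assms
    by (intro form_space_diff form_space_sum form_space_cmult taylor_form_in_form_space) auto
qed

text \<open>The summands with \<open>q > m\<close> are Taylor coefficients of \<open>z^m\<close>
  beyond its degree. The right side is the pairing of the first sum in \<open>dual_form\<close> with
  \<open>hpoly m\<close>.\<close>

lemma Gammacoef_eq:
  "Gammacoef r a n m s =
     (\<Sum>j=2..r. \<Sum>q<n j. vcoef r a n j q s * (fact q * coeff ([:node a j, 1:] ^ m) q))"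
  unfolding Gammacoef_def
proof (rule sum.cong[OF refl])
  fix j
  have "coeff ([:node a j, 1:] ^ m) q = 0" if "m < q" for q
    using that by (simp add: coeff_eq_0 degree_linear_power)
  then have "(\<Sum>q<n j. vcoef r a n j q s * (fact q * coeff ([:node a j, 1:] ^ m) q)) =
      (\<Sum>q<min (Suc m) (n j). vcoef r a n j q s * (fact q * coeff ([:node a j, 1:] ^ m) q))"
    by (intro sum.mono_neutral_right) auto
  also have "\<dots> = (\<Sum>q<min (Suc m) (n j).
        fact q * of_nat (m choose q) * node a j ^ (m - q) * vcoef r a n j q s)"
    by (intro sum.cong) (auto simp: coeff_linear_poly_power)
  finally show "(\<Sum>q<min (Suc m) (n j).
        fact q * of_nat (m choose q) * node a j ^ (m - q) * vcoef r a n j q s) =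
      (\<Sum>q<n j. vcoef r a n j q s * (fact q * coeff ([:node a j, 1:] ^ m) q))"
    by (rule sym)
qed

lemma pcompose_monom_linear: "pcompose (monom 1 l) [:t, 1:] = [:t, 1:] ^ l"
  for t :: "'a::comm_ring_1"
  by (simp add: monom_altdef pcompose_power pcompose_pCons)

text \<open>In this range \<open>z^l\<close> equals its own Hermite interpolant; the coefficients of
  \<open>z^(n 1 + s)\<close> are compared.\<close>

lemma Gammacoef_high:
  assumes "inj_on a {1..r}" "a 1 = 0" "n 1 \<le> l" "l < msize r n"
  shows "Gammacoef r a n l s = (if l = n 1 + s then 1 else 0)"
proof -
  have "monom 1 l = (\<Sum>j=2..r. \<Sum>q<n j. smult (fact q * coeff ([:node a j, 1:] ^ l) q)
               (interp_poly r a n j q))"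
    using hermite_interpolation[of a r "monom 1 l" n] assms
    by (simp add: degree_monom_eq pcompose_monom_linear)
  then have "coeff (monom 1 l) (n 1 + s) = (\<Sum>j=2..r. \<Sum>q<n j.
      fact q * coeff ([:node a j, 1:] ^ l) q * coeff (interp_poly r a n j q) (n 1 + s))"
    by (simp add: coeff_sum)
  then show ?thesis by (simp add: Gammacoef_eq vcoef_def mult_ac)
qed

lemma pairing_dual_form:
  assumes "r \<ge> 1" "inj_on a {1..r}" "a 1 = 0" "k < msize r n" "l < msize r n"
  shows "pairing (dual_form r a n k) (hpoly l) = (if k = l then 1 else 0)"
proof -
  have tf: "pairing (taylor_form a j q) (hpoly l) = fact q * coeff ([:node a j, 1:] ^ l) q" for j q
    unfolding hpoly_def pairing_taylor_form pcompose_monom_linear ..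
  \<comment> \<open>The first node is 0, so \<open>taylor_form a 1 q\<close> sees only the
    coefficient of \<open>z^q\<close>.\<close>
  have tf1: "pairing (taylor_form a 1 q) (hpoly l) = (if q = l then fact q else 0)" for q
    using assms(3) unfolding hpoly_def pairing_taylor_form by (simp add: node_def)
  show ?thesis
  proof (cases "k < n 1")
    case True
    then show ?thesis by (simp only: dual_form_low pairing_cmult_left tf1) simp
  next
    case False
    let ?s = "k - n 1"
    have "pairing (dual_form r a n k) (hpoly l) =
        (\<Sum>j=2..r. \<Sum>q<n j. vcoef r a n j q ?s * (fact q * coeff ([:node a j, 1:] ^ l) q)) -
        (\<Sum>m<n 1. Gammacoef r a n m ?s / fact m * (if m = l then fact m else 0))"
    proof -
      have in1: "taylor_form a j q \<in> form_space r a n" if "j \<in> {2..r}" "q < n j" for j q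
        using that by (intro taylor_form_in_form_space) auto
      have in2: "taylor_form a 1 q \<in> form_space r a n" if "q < n 1" for q
        using that assms(1) by (intro taylor_form_in_form_space) auto
      have "pairing (\<lambda>y. \<Sum>j=2..r. \<Sum>q<n j. vcoef r a n j q ?s * taylor_form a j q y) (hpoly l) =
          (\<Sum>j=2..r. pairing (\<lambda>y. \<Sum>q<n j. vcoef r a n j q ?s * taylor_form a j q y) (hpoly l))"
        by (intro pairing_sum_left[of _ _ r a n] form_space_sum form_space_cmult in1) auto
      also have "\<dots> = (\<Sum>j=2..r. \<Sum>q<n j. pairing (\<lambda>y. vcoef r a n j q ?s * taylor_form a j q y) (hpoly l))"
        by (intro sum.cong refl pairing_sum_left[of _ _ r a n] form_space_cmult in1) auto
      finally have 1: "pairing (\<lambda>y. \<Sum>j=2..r. \<Sum>q<n j. vcoef r a n j q ?s * taylor_form a j q y) (hpoly l) =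
          (\<Sum>j=2..r. \<Sum>q<n j. vcoef r a n j q ?s * (fact q * coeff ([:node a j, 1:] ^ l) q))"
        by (simp only: pairing_cmult_left tf)
      have 2: "pairing (\<lambda>y. \<Sum>m<n 1. Gammacoef r a n m ?s / fact m * taylor_form a 1 m y) (hpoly l) =
          (\<Sum>m<n 1. pairing (\<lambda>y. Gammacoef r a n m ?s / fact m * taylor_form a 1 m y) (hpoly l))"
        by (intro pairing_sum_left[of _ _ r a n] form_space_cmult in2) auto
      have "dual_form r a n k = (\<lambda>y.
          (\<Sum>j=2..r. \<Sum>q<n j. vcoef r a n j q ?s * taylor_form a j q y) -
          (\<Sum>m<n 1. Gammacoef r a n m ?s / fact m * taylor_form a 1 m y))"
        using False by (rule dual_form_high)
      moreover have "pairing \<dots> (hpoly l) =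
          pairing (\<lambda>y. \<Sum>j=2..r. \<Sum>q<n j. vcoef r a n j q ?s * taylor_form a j q y) (hpoly l) -
          pairing (\<lambda>y. \<Sum>m<n 1. Gammacoef r a n m ?s / fact m * taylor_form a 1 m y) (hpoly l)"
        by (intro pairing_diff_left[of _ r a n] form_space_sum form_space_cmult in1 in2) auto
      ultimately show ?thesis
        by (simp only: 1 2 pairing_cmult_left tf1)
    qed
    also have "\<dots> = Gammacoef r a n l ?s - (if l < n 1 then Gammacoef r a n l ?s else 0)"
    proof -
      have "(\<Sum>m<n 1. Gammacoef r a n m ?s / fact m * (if m = l then fact m else 0)) =
          (\<Sum>m<n 1. if m = l then Gammacoef r a n m ?s else 0)"
        by (intro sum.cong) auto
      then show ?thesis by (simp add: Gammacoef_eq[of r a n l])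
    qed
    also have "\<dots> = (if k = l then 1 else 0)"
      using False Gammacoef_high[OF assms(2,3) _ assms(5), of ?s] by auto
    finally show ?thesis .
  qed
qed


section \<open>Type I forms and the kernel\<close>

lemma is_type_I_form_iff:
  "is_type_I_form r (weight a) m Q \<longleftrightarrow> Q \<in> form_space r a m \<and>
     (\<forall>k<msize r m. pairing Q (monom 1 k) = (if k = msize r m - 1 then 1 else 0))"
proof -
  have "has_bochner_integral lborel (\<lambda>x. Q x * x ^ k) c \<longleftrightarrow> pairing Q (monom 1 k) = c"
    if "Q \<in> form_space r a m" for k c
    using form_space_integrable[OF that, of "monom 1 k"]
    by (auto simp: has_bochner_integral_iff pairing_def poly_monom)
  then show ?thesis
    unfolding is_type_I_form_def form_space_def by blast
qed

text \<open>The last dual form annihilates every \<open>hpoly i\<close> of smaller degree, and these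
  span all polynomials of smaller degree.\<close>

lemma is_type_I_form_dual_form:
  assumes "r \<ge> 1" "inj_on a {1..r}" "a 1 = 0" "msize r m \<ge> 1"
  shows "is_type_I_form r (weight a) m (dual_form r a m (msize r m - 1))"
  unfolding is_type_I_form_iff
proof (intro conjI allI impI)
  let ?Q = "dual_form r a m (msize r m - 1)"
  show in_space: "?Q \<in> form_space r a m" by (rule dual_form_in_form_space[OF assms(1)])
  fix k assume k: "k < msize r m"
  \<comment> \<open>The coefficients of \<open>g\<close> are those of \<open>z^k\<close> in the
    Hermite basis, with top coefficient 1.\<close>
  obtain g where g: "heat g = monom 1 k" using surj_heat by blast
  have deg: "degree g = k" using degree_heat[of g] by (simp add: g degree_monom_eq)
  have lc: "coeff g k = 1" using lead_coeff_heat[of g] by (simp add: g deg degree_monom_eq)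
  have "pairing ?Q (heat g) = (\<Sum>i\<le>k. coeff g i * (if msize r m - 1 = i then 1 else 0))"
    unfolding pairing_heat_eq_sum_hpoly[OF in_space] deg
    using k assms by (intro sum.cong refl) (subst pairing_dual_form, auto)
  then show "pairing ?Q (monom 1 k) = (if k = msize r m - 1 then 1 else 0)"
    using k lc by (auto simp: g if_distrib cong: if_cong)
qed

lemma form_space_eqI:
  assumes "inj_on a {1..r}" "Q \<in> form_space r a m" "R \<in> form_space r a m"
    and "\<And>p. degree p < msize r m \<Longrightarrow> pairing Q p = pairing R p"
  shows "Q = R"
proof
  fix x
  have "Q x - R x = 0"
  proof (rule form_space_nondegenerate[OF assms(1) form_space_diff[OF assms(2,3)]])
    fix f :: "real poly" assume "degree f < msize r m"
    then have "pairing Q (heat f) = pairing R (heat f)" by (intro assms(4)) simp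
    then show "pairing (\<lambda>x. Q x - R x) (heat f) = 0"
      by (simp add: pairing_diff_left[OF assms(2,3)])
  qed
  then show "Q x = R x" by simp
qed

lemma is_type_I_form_unique:
  assumes "inj_on a {1..r}" "is_type_I_form r (weight a) m Q" "is_type_I_form r (weight a) m R"
  shows "Q = R"
proof (rule form_space_eqI[OF assms(1)])
  show Q: "Q \<in> form_space r a m" and R: "R \<in> form_space r a m"
    using assms(2,3) by (simp_all add: is_type_I_form_iff)
  fix p :: "real poly" assume "degree p < msize r m"
  then show "pairing Q p = pairing R p"
    unfolding pairing_eq_sum_monom[OF Q, of p] pairing_eq_sum_monom[OF R, of p]
    using assms(2,3) by (intro sum.cong) (auto simp: is_type_I_form_iff)
qed

lemma is_type_I_form_type_I_form:
  assumes "r \<ge> 1" "inj_on a {1..r}" "a 1 = 0" "msize r m \<ge> 1"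
  shows "is_type_I_form r (weight a) m (type_I_form r (weight a) m)"
  unfolding type_I_form_def
proof (rule theI[of "is_type_I_form r (weight a) m" "dual_form r a m (msize r m - 1)"])
  show "is_type_I_form r (weight a) m (dual_form r a m (msize r m - 1))"
    by (rule is_type_I_form_dual_form[OF assms])
qed (rule is_type_I_form_unique[OF assms(2) _ is_type_I_form_dual_form[OF assms]])

lemma pairing_type_I:
  assumes "is_type_I_form r (weight a) m Q" "degree p < msize r m"
  shows "pairing Q p = coeff p (msize r m - 1)"
proof -
  have Q: "Q \<in> form_space r a m" using assms(1) by (simp add: is_type_I_form_iff)
  have "pairing Q p = (\<Sum>i\<le>degree p. coeff p i * (if i = msize r m - 1 then 1 else 0))"
    unfolding pairing_eq_sum_monom[OF Q, of p]
    using assms by (intro sum.cong) (auto simp: is_type_I_form_iff)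
  then show ?thesis
    by (simp add: if_distrib cong: if_cong) (simp add: coeff_eq_0 split: if_splits)
qed

lemma natural_path_mono: "i \<le> k \<Longrightarrow> natural_path n i j \<le> natural_path n k j"
  by (auto simp: natural_path_def)

text \<open>Induction along the path: step \<open>k\<close> extends the reproducing property to
  degree \<open>k\<close>, since the new type I form extracts the coefficient of \<open>z^k\<close>
  and the earlier sum annihilates the new type II polynomial.\<close>

lemma cd_kernel_partial:
  fixes x :: real
  assumes "r \<ge> 1" "inj_on a {1..r}" "a 1 = 0" "k \<le> msize r n"
  defines "K \<equiv> \<lambda>k y. \<Sum>i<k. poly (type_II r (weight a) (natural_path n i)) x *
                      type_I_form r (weight a) (natural_path n (Suc i)) y"
  shows "K k \<in> form_space r a (natural_path n k) \<and>
         (\<forall>p. p = 0 \<or> degree p < k \<longrightarrow> pairing (K k) p = poly p x)"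
  using assms(4)
proof (induction k)
  case 0
  then show ?case by (simp add: K_def pairing_def)
next
  case (Suc k)
  let ?m = "natural_path n k" and ?m' = "natural_path n (Suc k)"
  define P where "P = heat (node_poly r a ?m)"
  define Q where "Q = type_I_form r (weight a) ?m'"
  have IH: "K k \<in> form_space r a ?m"
    "p = 0 \<or> degree p < k \<Longrightarrow> pairing (K k) p = poly p x" for p
    using Suc by auto
  have P: "degree P = k" "coeff P k = 1"
    using Suc.prems lead_coeff_heat[of "node_poly r a ?m"] lead_coeff_node_poly[of r a ?m]
    by (simp_all add: P_def degree_node_poly msize_natural_path)
  have Q: "is_type_I_form r (weight a) ?m' Q" and size: "msize r ?m' = Suc k"
    using is_type_I_form_type_I_form[OF assms(1-3), of ?m'] Suc.prems
    by (simp_all add: Q_def msize_natural_path)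
  have Q_in: "Q \<in> form_space r a ?m'" using Q by (simp add: is_type_I_form_iff)
  have K_in: "K k \<in> form_space r a ?m'"
    using IH(1) by (rule form_space_mono) (simp add: natural_path_mono)
  have K_Suc: "K (Suc k) = (\<lambda>y. K k y + poly P x * Q y)"
    by (simp add: K_def P_def Q_def type_II_weight[OF assms(2)])
  show ?case
  proof (intro conjI allI impI)
    show "K (Suc k) \<in> form_space r a ?m'"
      unfolding K_Suc by (intro form_space_add form_space_cmult K_in Q_in)
    fix p :: "real poly" assume "p = 0 \<or> degree p < Suc k"
    then have p: "degree p \<le> k" by auto
    \<comment> \<open>Subtracting a multiple of the monic \<open>P\<close> removes the coefficient
      of degree \<open>k\<close>, so the induction hypothesis applies to the rest.\<close>
    define p' where "p' = p - smult (coeff p k) P"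
    have "degree p' \<le> k"
      unfolding p'_def using p P
      by (intro degree_diff_le) (auto intro: order_trans[OF degree_smult_le])
    moreover have "coeff p' k = 0" by (simp add: p'_def P)
    ultimately have p': "p' = 0 \<or> degree p' < k" by (rule eq_zero_or_degree_less)
    have p_eq: "p = p' + smult (coeff p k) P" by (simp add: p'_def)
    have "pairing (K k) P = 0"
      unfolding P_def by (rule pairing_node_poly_eq_0[OF assms(2) IH(1)]) simp
    then have "pairing (K k) p = poly p' x"
      using IH(2)[OF p']
      by (subst p_eq) (simp add: pairing_add_right[OF IH(1)] pairing_smult_right)
    moreover have "pairing Q p = coeff p k"
      using pairing_type_I[OF Q, of p] p by (simp add: size)
    ultimately have "pairing (K (Suc k)) p = poly p' x + poly P x * coeff p k"
      unfolding K_Suc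
      by (simp add: pairing_add_left[OF K_in form_space_cmult[OF Q_in]] pairing_cmult_left)
    also have "\<dots> = poly p x" by (simp add: p'_def)
    finally show "pairing (K (Suc k)) p = poly p x" .
  qed
qed

lemma cd_kernel_eq_dual_forms:
  assumes "r \<ge> 1" "inj_on a {1..r}" "a 1 = 0"
  shows "cd_kernel r (weight a) n x y = (\<Sum>k<msize r n. poly (hpoly k) x * dual_form r a n k y)"
proof -
  let ?R = "\<lambda>y. \<Sum>k<msize r n. poly (hpoly k) x * dual_form r a n k y"
  note in_dual = dual_form_in_form_space[OF assms(1), of a n]
  have K: "cd_kernel r (weight a) n x \<in> form_space r a (natural_path n (msize r n))"
    "degree p < msize r n \<Longrightarrow> pairing (cd_kernel r (weight a) n x) p = poly p x" for p
    using cd_kernel_partial[OF assms order_refl, of n x] by (auto simp: cd_kernel_def[abs_def])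
  have R: "?R \<in> form_space r a n"
    by (intro form_space_sum form_space_cmult in_dual)
  have "cd_kernel r (weight a) n x = ?R"
  proof (rule form_space_eqI[OF assms(2) _ R])
    \<comment> \<open>The path ends at \<open>n\<close> on the components \<open>1..r\<close>, not
      necessarily as a function, hence the passage through \<open>form_space_mono\<close>.\<close>
    show "cd_kernel r (weight a) n x \<in> form_space r a n"
      using K(1) by (rule form_space_mono) (simp add: natural_path_end)
    fix p :: "real poly" assume p: "degree p < msize r n"
    obtain g where g: "heat g = p" using surj_heat by blast
    have deg: "degree g < msize r n" using degree_heat[of g] p by (simp add: g)
    have "pairing ?R (hpoly l) = poly (hpoly l) x" if "l < msize r n" for l
    proof -
      have "pairing ?R (hpoly l) =
          (\<Sum>k<msize r n. pairing (\<lambda>y. poly (hpoly k) x * dual_form r a n k y) (hpoly l))"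
        by (intro pairing_sum_left[of _ _ r a n] form_space_cmult in_dual)
      also have "\<dots> = (\<Sum>k<msize r n. poly (hpoly k) x * (if k = l then 1 else 0))"
        unfolding pairing_cmult_left
        using that assms by (intro sum.cong refl) (subst pairing_dual_form, auto)
      finally show ?thesis using that by (simp add: if_distrib cong: if_cong)
    qed
    then have "pairing ?R (heat g) = poly (heat g) x"
      unfolding pairing_heat_eq_sum_hpoly[OF R]
      unfolding heat_eq_sum_hpoly[of g] poly_sum poly_smult
      using deg by (intro sum.cong) auto
    then show "pairing (cd_kernel r (weight a) n x) p = pairing ?R p"
      using K(2)[OF p] by (simp add: g)
  qed
  then show ?thesis by simp
qed

section \<open>Return to the explicit coefficients\<close>

lemma hpoly_translate:
  "pcompose (hpoly q) [:- t, 1:] =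
     (\<Sum>b\<le>q. smult ((-1) ^ (q - b) * t ^ (q - b) * of_nat (q choose b)) (hpoly b))"
proof -
  have "pcompose (hpoly q) [:- t, 1:] = heat ([:- t, 1:] ^ q)"
    by (simp add: hpoly_def pcompose_monom_linear flip: heat_translate)
  also have "\<dots> = (\<Sum>b\<le>q. smult (coeff ([:- t, 1:] ^ q) b) (hpoly b))"
    by (subst heat_eq_sum_hpoly) (simp add: degree_linear_power)
  also have "\<dots> = (\<Sum>b\<le>q. smult ((-1) ^ (q - b) * t ^ (q - b) * of_nat (q choose b)) (hpoly b))"
    by (intro sum.cong refl)
       (simp add: coeff_linear_poly_power power_minus[of t] mult_ac)
  finally show ?thesis .
qed

lemma sum_triangle:
  "(\<Sum>q<m. \<Sum>b\<le>q. f q b) = (\<Sum>b<m. \<Sum>q=b..<m. f q b)" for f :: "nat \<Rightarrow> nat \<Rightarrow> real"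
  unfolding sum.Sigma[OF finite_lessThan ballI[OF finite_atMost]]
    sum.Sigma[OF finite_lessThan ballI[OF finite_atLeastLessThan]]
  by (rule sum.reindex_bij_witness[of _ "\<lambda>(b, q). (q, b)" "\<lambda>(q, b). (b, q)"]) auto

text \<open>The shifted Hermite polynomials in \<open>taylor_form\<close> expand binomially, because
  \<open>heat\<close> commutes with translation. Interchanging the triangular sum collects the
  coefficient of each unshifted one.\<close>

lemma sum_Ucoef:
  "(\<Sum>q<n j. vcoef r a n j q s * taylor_form a j q y) =
     (\<Sum>b<n j. Ucoef r a n j b s * poly (hpoly b) y * weight a j y)"
proof -
  let ?t = "node a j"
  let ?c = "exp (- (?t\<^sup>2)) / sqrt pi"
  let ?u = "\<lambda>q b. (-1) ^ (q - b) * 2 ^ q * ?t ^ (q - b) * of_nat (q choose b) * vcoef r a n j q s"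
  have "(\<Sum>q<n j. vcoef r a n j q s * taylor_form a j q y) =
      (\<Sum>q<n j. \<Sum>b\<le>q. ?c * ?u q b * poly (hpoly b) y * weight a j y)"
    unfolding taylor_form_def hpoly_translate poly_sum sum_distrib_left sum_distrib_right
    by (intro sum.cong refl) (simp add: mult_ac)
  also have "\<dots> = (\<Sum>b<n j. \<Sum>q=b..<n j. ?c * ?u q b * poly (hpoly b) y * weight a j y)"
    by (rule sum_triangle)
  also have "\<dots> = (\<Sum>b<n j. Ucoef r a n j b s * poly (hpoly b) y * weight a j y)"
    unfolding Ucoef_def sum_distrib_left sum_distrib_right ..
  finally show ?thesis .
qed

lemma sum_lessThan_add:
  "(\<Sum>k<u + v. f k) = (\<Sum>k<u. f k) + (\<Sum>s<v. f (u + s))" for f :: "nat \<Rightarrow> real"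
  by (induction v) (simp_all add: add.assoc)

theorem corollary3p4:
  fixes r N :: nat and n :: "nat \<Rightarrow> nat" and a :: "nat \<Rightarrow> real" and x y :: real
  assumes "r \<ge> 2"
    and "msize r n \<ge> 1"
    and "N = msize r n - n 1"
    and "a 1 = 0"
    and "inj_on a {1..r}"
  shows "cd_kernel r (weight a) n x y =
    exp (- (y\<^sup>2)) *
      (\<Sum>m<n 1. 2 ^ m * hermite_monic m y / (sqrt pi * fact m) *
         (hermite_monic m x - (\<Sum>s<N. Gammacoef r a n m s * hermite_monic (n 1 + s) x)))
    + (\<Sum>s<N. \<Sum>j=2..r. \<Sum>b<n j.
         Ucoef r a n j b s * hermite_monic (n 1 + s) x * hermite_monic b y *
         exp (a j * y - y\<^sup>2))"
proof -
  let ?h = "\<lambda>k z. poly (hpoly k) z"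
  let ?E = "exp (- (y\<^sup>2))"
  have r: "r \<ge> 1" using assms(1) by simp
  have "n 1 \<le> msize r n"
    unfolding msize_def using assms(1) by (intro member_le_sum) auto
  then have size: "msize r n = n 1 + N" using assms(3) by simp
  have tf1: "taylor_form a 1 m y = 2 ^ m / sqrt pi * ?h m y * ?E" for m
    using assms(4) by (simp add: taylor_form_def weight_def node_def)
  \<comment> \<open>\<open>C m\<close> is the value at \<open>y\<close> of a low dual form;
    \<open>V s\<close> is the contribution of the nodes \<open>2..r\<close> to a high one.\<close>
  define C where "C m = 2 ^ m * ?h m y / (sqrt pi * fact m) * ?E" for m
  define G where "G s m = Gammacoef r a n m s" for s m
  define V where "V s = (\<Sum>j=2..r. \<Sum>b<n j. Ucoef r a n j b s * ?h b y * weight a j y)" for s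
  have low: "dual_form r a n m y = C m" if "m < n 1" for m
    unfolding dual_form_low[of m n r a, OF that] tf1 C_def by simp
  have high: "dual_form r a n (n 1 + s) y = V s - (\<Sum>m<n 1. G s m * C m)" for s
  proof -
    have "Gammacoef r a n m s / fact m * taylor_form a 1 m y = G s m * C m" for m
      unfolding tf1 C_def G_def by simp
    then show ?thesis
      using dual_form_high[of "n 1 + s" n r a] by (simp add: sum_Ucoef V_def)
  qed
  have "cd_kernel r (weight a) n x y =
      (\<Sum>m<n 1. ?h m x * C m) + (\<Sum>s<N. ?h (n 1 + s) x * (V s - (\<Sum>m<n 1. G s m * C m)))"
    unfolding cd_kernel_eq_dual_forms[OF r assms(5,4)] size sum_lessThan_add high
    by (intro arg_cong2[where f = "(+)"] sum.cong refl) (simp add: low del: One_nat_def)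
  \<comment> \<open>The corrections subtracted in the high dual forms are regrouped by
    \<open>C m\<close>, which produces the bracket with \<open>Gammacoef\<close>.\<close>
  also have "\<dots> = (\<Sum>m<n 1. C m * (?h m x - (\<Sum>s<N. G s m * ?h (n 1 + s) x)))
      + (\<Sum>s<N. ?h (n 1 + s) x * V s)"
  proof -
    have "(\<Sum>s<N. ?h (n 1 + s) x * (\<Sum>m<n 1. G s m * C m)) =
        (\<Sum>m<n 1. C m * (\<Sum>s<N. G s m * ?h (n 1 + s) x))"
      unfolding sum_distrib_left by (subst sum.swap) (simp add: mult_ac)
    then show ?thesis
      by (simp add: right_diff_distrib sum_subtractf mult.commute)
  qed
  also have "(\<Sum>m<n 1. C m * (?h m x - (\<Sum>s<N. G s m * ?h (n 1 + s) x))) =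
      ?E * (\<Sum>m<n 1. 2 ^ m * ?h m y / (sqrt pi * fact m) *
         (?h m x - (\<Sum>s<N. G s m * ?h (n 1 + s) x)))"
    unfolding C_def sum_distrib_left by (intro sum.cong refl) (simp only: mult_ac)
  also have "(\<Sum>s<N. ?h (n 1 + s) x * V s) = (\<Sum>s<N. \<Sum>j=2..r. \<Sum>b<n j.
         Ucoef r a n j b s * ?h (n 1 + s) x * ?h b y * exp (a j * y - y\<^sup>2))"
    unfolding V_def sum_distrib_left weight_def by (intro sum.cong refl) (simp only: mult_ac)
  finally show ?thesis unfolding hermite_monic_eq_poly G_def .
qed

end
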